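(* Let $H$ and $S$ be fixed graphs, $H$ with no isolated vertices, and set $v=|V(H)|$ and $\bar\gamma=\bar\gamma(S,H)$. Then \[ \lim_{n\to\infty}\Pr{S\subseteq \bar G(H,n,m)}=\begin{cases}0 & m\ll n^{v-\bar\gamma},\\ 1 & m\gg n^{v-\bar\gamma}.\end{cases} \]
   Context: A copy of $H$ in $K_n$ is a subgraph of the complete graph on $[n]$ isomorphic to $H$. The uniform random motif graph $\bar G(H,n,m)$ is the union of $m$ copies of $H$ in $K_n$ chosen uniformly at random without replacement; $S\subseteq \bar G(H,n,m)$ means that $\bar G(H,n,m)$ contains a subgraph isomorphic to $S$. Fix $S$ on some vertex set. A family $\{H_1,\dots,H_b\}$ of $b$ distinct graphs, each isomorphic to $H$, on vertex sets within a common ground set containing $V(S)$, is an $(a,b)$ covering of $S$ if (i) $S\subseteq\bigcup_{j=1}^b H_j$, (ii) $|V(\bigcup_{j=1}^b H_j)|=a$, and (iii) for every $\ell\in[b]$, $S\not\subseteq\bigcup_{j\neq \ell}H_j$. Coverings are grouped into configurations (isomorphism types of the placement of the $b$ copies of $H$ on the $a$ vertices relative to $S$). For a subfamily $\{F_1,\dots,F_{b'}\}$ with exactly $b'\ge1$ elements of a covering, with $|V(\bigcup_{\ell=1}^{b'}F_\ell)|=a'$, call it an $(a',b')$ subset. For a covering $C$ (equivalently, its configuration), $\gamma(C)=\min a'/b'$ over all $(a',b')$ subsets of $C$, and $\bar\gamma(S,H)=\max_C\gamma(C)$ over all coverings (configurations) of $S$ by copies of $H$. *)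

theory Defs
  imports
    "HOL-Probability.Probability"
    "HOL-Library.Landau_Symbols"
    "HOL-Library.Infinite_Typeclass"
begin

type_synonym 'a ugraph = "'a set \<times> 'a set set"

abbreviation verts :: "'a ugraph \<Rightarrow> 'a set" where "verts \<equiv> fst"
abbreviation edges :: "'a ugraph \<Rightarrow> 'a set set" where "edges \<equiv> snd"

definition simple_graph :: "'a ugraph \<Rightarrow> bool" where
  "simple_graph G \<longleftrightarrow> finite (verts G) \<and> (\<forall>e\<in>edges G. e \<subseteq> verts G \<and> card e = 2)"

definition no_isolated :: "'a ugraph \<Rightarrow> bool" where
  "no_isolated G \<longleftrightarrow> (\<forall>x\<in>verts G. \<exists>e\<in>edges G. x \<in> e)"

definition subgraph :: "'a ugraph \<Rightarrow> 'a ugraph \<Rightarrow> bool" where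
  "subgraph F G \<longleftrightarrow> verts F \<subseteq> verts G \<and> edges F \<subseteq> edges G"

definition isomorphic :: "'a ugraph \<Rightarrow> 'b ugraph \<Rightarrow> bool" where
  "isomorphic G H \<longleftrightarrow>
     (\<exists>f. bij_betw f (verts G) (verts H) \<and> edges H = (\<lambda>e. f ` e) ` edges G)"

definition graph_Union :: "'a ugraph set \<Rightarrow> 'a ugraph" where
  "graph_Union C = (\<Union>(verts ` C), \<Union>(edges ` C))"

definition complete_graph :: "nat \<Rightarrow> nat ugraph" where
  "complete_graph n = ({1..n}, {e. e \<subseteq> {1..n} \<and> card e = 2})"

definition copies :: "'h ugraph \<Rightarrow> nat \<Rightarrow> nat ugraph set" where
  "copies H n = {F. simple_graph F \<and> subgraph F (complete_graph n) \<and> isomorphic H F}"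

(* Meaningful only for m \<le> card (copies H n): otherwise no m copies can be chosen, and
   pmf_of_set is applied to the empty set. *)
definition motif_graph :: "'h ugraph \<Rightarrow> nat \<Rightarrow> nat \<Rightarrow> nat ugraph pmf" where
  "motif_graph H n m =
     map_pmf graph_Union (pmf_of_set {\<F>. \<F> \<subseteq> copies H n \<and> card \<F> = m})"

definition contains_copy :: "'a ugraph \<Rightarrow> 'b ugraph \<Rightarrow> bool" where
  "contains_copy G S \<longleftrightarrow> (\<exists>F. simple_graph F \<and> subgraph F G \<and> isomorphic S F)"

(* The ground set is the whole vertex type of S. It has to be infinite, so that the copies of H
   always have room for vertices outside S. Here S is a fixed labelled graph, so containment of S
   is plain inclusion, not inclusion up to isomorphism. *)
definition covering ::
  "'h ugraph \<Rightarrow> 's::infinite ugraph \<Rightarrow> nat \<Rightarrow> nat \<Rightarrow> 's ugraph set \<Rightarrow> bool" where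
  "covering H S a b C \<longleftrightarrow>
     finite C \<and> card C = b \<and> (\<forall>F\<in>C. simple_graph F \<and> isomorphic H F) \<and>
     subgraph S (graph_Union C) \<and>
     card (verts (graph_Union C)) = a \<and>
     (\<forall>F\<in>C. \<not> subgraph S (graph_Union (C - {F})))"

definition cover_subset :: "'s ugraph set \<Rightarrow> nat \<Rightarrow> nat \<Rightarrow> 's ugraph set \<Rightarrow> bool" where
  "cover_subset C a' b' D \<longleftrightarrow>
     D \<subseteq> C \<and> 1 \<le> b' \<and> card D = b' \<and> card (verts (graph_Union D)) = a'"

definition gamma :: "'s ugraph set \<Rightarrow> real" where
  "gamma C = Min {real a' / real b' |a' b'. \<exists>D. cover_subset C a' b' D}"

(* Isomorphic coverings have the same gamma, so a maximum over configurations is a maximum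
   over coverings. *)
definition gamma_bar :: "'s::infinite ugraph \<Rightarrow> 'h ugraph \<Rightarrow> real" where
  "gamma_bar S H = Max {gamma C |C. \<exists>a b. covering H S a b C}"

(* The next two lemmas show that Min and Max above are taken over finite sets. *)

lemma finite_gamma_values:
  assumes "finite C"
  shows "finite {real a' / real b' |a' b'. \<exists>D. cover_subset C a' b' D}"
proof -
  have "{real a' / real b' |a' b'. \<exists>D. cover_subset C a' b' D}
      \<subseteq> (\<lambda>D. real (card (verts (graph_Union D))) / real (card D)) ` Pow C"
    unfolding cover_subset_def by blast
  then show ?thesis
    by (rule finite_subset) (simp add: assms)
qed

lemma finite_gamma_bar_values:
  fixes S :: "'s::infinite ugraph" and H :: "'h ugraph"
  assumes S: "simple_graph S" "verts S \<noteq> {}"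
  shows "finite {gamma C |C. \<exists>a b. covering H S a b C}"
proof -
  define B where "B = card (verts S) + card (edges S)"
  define v where "v = card (verts H)"
  have finE: "finite (edges S)"
    by (rule finite_subset[of _ "Pow (verts S)"]) (use S in \<open>auto simp: simple_graph_def\<close>)
  have finV: "finite (verts S)"
    using S by (simp add: simple_graph_def)
  have mem: "gamma C \<in> (\<lambda>(a, b). real a / real b) ` ({..B * v} \<times> {..B})"
    if cov: "covering H S a b C" for C a b
  proof -
    have finC: "finite C" and sub: "subgraph S (graph_Union C)"
      and min: "\<And>F. F \<in> C \<Longrightarrow> \<not> subgraph S (graph_Union (C - {F}))"
      and copy: "\<And>F. F \<in> C \<Longrightarrow> isomorphic H F"
      using cov by (auto simp: covering_def)
    let ?I = "(Inl ` verts S \<union> Inr ` edges S) :: ('s + 's set) set"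
    define P where "P = (\<lambda>(F::'s ugraph) z. case z of Inl x \<Rightarrow> x \<in> verts F | Inr e \<Rightarrow> e \<in> edges F)"
    have "\<exists>z\<in>?I. P F z \<and> (\<forall>F'\<in>C. P F' z \<longrightarrow> F' = F)" if F: "F \<in> C" for F
    proof -
      from min[OF F] consider x where "x \<in> verts S" "x \<notin> \<Union>(verts ` (C - {F}))"
        | e where "e \<in> edges S" "e \<notin> \<Union>(edges ` (C - {F}))"
        unfolding subgraph_def graph_Union_def by auto
      then show ?thesis
      proof cases
        case 1
        with sub have "x \<in> \<Union>(verts ` C)"
          unfolding subgraph_def graph_Union_def by auto
        with 1 have "P F (Inl x)" "\<forall>F'\<in>C. P F' (Inl x) \<longrightarrow> F' = F"
          unfolding P_def by auto
        then show ?thesis using 1 by blast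
      next
        case 2
        with sub have "e \<in> \<Union>(edges ` C)"
          unfolding subgraph_def graph_Union_def by auto
        with 2 have "P F (Inr e)" "\<forall>F'\<in>C. P F' (Inr e) \<longrightarrow> F' = F"
          unfolding P_def by auto
        then show ?thesis using 2 by blast
      qed
    qed
    then obtain z where z: "\<And>F. F \<in> C \<Longrightarrow> z F \<in> ?I \<and> P F (z F) \<and> (\<forall>F'\<in>C. P F' (z F) \<longrightarrow> F' = F)"
      by metis
    have "inj_on z C" by (rule inj_onI) (metis z)
    moreover have "z ` C \<subseteq> ?I" using z by blast
    ultimately have "card C \<le> card ?I"
      by (rule card_inj_on_le) (simp add: finE finV)
    also have "\<dots> \<le> card (Inl ` verts S :: ('s + 's set) set) + card (Inr ` edges S :: ('s + 's set) set)"
      by (rule card_Un_le)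
    also have "\<dots> = B" by (simp add: B_def card_image)
    finally have CB: "card C \<le> B" .
    have "C \<noteq> {}"
      using sub S by (auto simp: subgraph_def graph_Union_def)
    then obtain F where "F \<in> C" by blast
    then have "cover_subset C (card (verts (graph_Union {F}))) 1 {F}"
      by (auto simp: cover_subset_def)
    then have "gamma C \<in> {real a' / real b' |a' b'. \<exists>D. cover_subset C a' b' D}"
      unfolding gamma_def by (intro Min_in finite_gamma_values finC) blast
    then obtain D where D: "D \<subseteq> C"
      "gamma C = real (card (verts (graph_Union D))) / real (card D)"
      by (auto simp: cover_subset_def)
    have DB: "card D \<le> B" using card_mono[OF finC D(1)] CB by simp
    have "card (verts (graph_Union D)) \<le> (\<Sum>F\<in>D. card (verts F))"
      unfolding graph_Union_def using card_UN_le[OF finite_subset[OF D(1) finC]] by simp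
    also have "\<dots> = (\<Sum>F\<in>D. v)"
    proof (rule sum.cong)
      fix F assume "F \<in> D"
      then have "isomorphic H F" using D(1) copy by blast
      then obtain f where "bij_betw f (verts H) (verts F)" unfolding isomorphic_def by blast
      then show "card (verts F) = v" unfolding v_def by (simp add: bij_betw_same_card)
    qed simp
    also have "\<dots> \<le> B * v" using DB by simp
    finally show ?thesis using D(2) DB by force
  qed
  have "{gamma C |C. \<exists>a b. covering H S a b C}
      \<subseteq> (\<lambda>(a, b). real a / real b) ` ({..B * v} \<times> {..B})"
    using mem by blast
  then show ?thesis by (rule finite_subset) auto
qed

end

theory Submission
  imports Defs
begin

text \<open>
  Write \<open>p = m / N\<close>, where \<open>N\<close>, of order \<open>n ^ v\<close>, is the number of copies of \<open>H\<close> in \<open>K\<^sub>n\<close>,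
  and \<open>\<gamma>\<close> for \<open>gamma_bar S H\<close>.

  If \<open>S\<close> occurs in the union, then the chosen copies contain a minimal cover of a copy of \<open>S\<close>.
  Moved into the vertex type of \<open>S\<close> it becomes a covering \<open>C\<close> with \<open>\<gamma>(C) \<le> \<gamma>\<close>, so it has a
  nonempty subfamily of \<open>b'\<close> copies on \<open>a' \<le> \<gamma> b'\<close> vertices. There are \<open>O(n ^ a')\<close> such families,
  each chosen with probability at most \<open>p ^ b'\<close>, and \<open>n ^ a' p ^ b' \<le> (n ^ \<gamma> p) ^ b'\<close> tends to 0 when
  \<open>m / n ^ (v - \<gamma>)\<close> tends to 0.

  Conversely, take a covering \<open>C\<close> with \<open>\<gamma>(C) = \<gamma>\<close>, with \<open>b\<close> copies on the vertex set \<open>V\<close>, and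
  count the injections \<open>\<phi>\<close> of \<open>V\<close> into \<open>[n]\<close> for which all copies in \<open>\<phi>(C)\<close> are chosen. Pairs \<open>\<phi>, \<psi>\<close>
  with disjoint images of \<open>C\<close> are negatively correlated. The pairs with
  \<open>\<phi>(C) \<inter> \<psi>(C) = \<phi>(D)\<close>, where \<open>D\<close> has \<open>b'\<close> copies on \<open>a'\<close> vertices, contribute
  \<open>O(1 / (n ^ a' p ^ b'))\<close> to the variance divided by the squared mean, which tends to 0 when
  \<open>m / n ^ (v - \<gamma>)\<close> tends to infinity. Chebyshev's inequality concludes.
\<close>

section \<open>Images of graphs and numbers of copies\<close>

text \<open>Coverings live on the vertex type of \<open>S\<close>, motif graphs on the natural
  numbers. Every passage between the two, in either direction, goes through this map.\<close>

definition map_graph :: "('a \<Rightarrow> 'b) \<Rightarrow> 'a ugraph \<Rightarrow> 'b ugraph" where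
  "map_graph f G = (f ` verts G, (`) f ` edges G)"

lemma verts_map_graph [simp]: "verts (map_graph f G) = f ` verts G"
  and edges_map_graph [simp]: "edges (map_graph f G) = (`) f ` edges G"
  by (simp_all add: map_graph_def)

lemma simple_graph_map:
  assumes "simple_graph G" "inj_on f (verts G)"
  shows "simple_graph (map_graph f G)"
  using assms unfolding simple_graph_def
  by (auto simp: card_image inj_on_subset)

lemma isomorphic_map:
  assumes "isomorphic H G" "inj_on f (verts G)"
  shows "isomorphic H (map_graph f G)"
proof -
  obtain g where g: "bij_betw g (verts H) (verts G)" "edges G = (\<lambda>e. g ` e) ` edges H"
    using assms(1) unfolding isomorphic_def by blast
  have "bij_betw (f \<circ> g) (verts H) (f ` verts G)"
    using g(1) assms(2) by (rule bij_betw_trans[OF _ inj_on_imp_bij_betw])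
  then show ?thesis
    unfolding isomorphic_def using g(2) by (auto simp: image_image image_comp intro!: exI[of _ "f \<circ> g"])
qed

lemma isomorphic_map_graph_self:
  "inj_on f (verts G) \<Longrightarrow> isomorphic G (map_graph f G)"
  unfolding isomorphic_def by (auto intro!: exI[of _ f] inj_on_imp_bij_betw)

lemma isomorphic_card: "isomorphic H F \<Longrightarrow> card (verts F) = card (verts H)"
  unfolding isomorphic_def by (auto dest: bij_betw_same_card)

text \<open>Edges of a simple graph are subsets of its vertex set, and taking images is injective on
  \<open>Pow U\<close>. Hence transported families keep their cardinality.\<close>

lemma inj_on_map_graph:
  assumes "inj_on f U"
  shows "inj_on (map_graph f) {G. simple_graph G \<and> verts G \<subseteq> U}"
proof (rule inj_onI)
  fix G G' assume G: "G \<in> {G. simple_graph G \<and> verts G \<subseteq> U}"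
    and G': "G' \<in> {G. simple_graph G \<and> verts G \<subseteq> U}"
    and eq: "map_graph f G = map_graph f G'"
  have inj: "inj_on ((`) f) (Pow U)"
    using assms by (rule inj_on_image_Pow)
  have "verts G = verts G'"
    using inj_onD[OF inj, of "verts G" "verts G'"] G G' eq by (simp add: map_graph_def)
  moreover have "edges G = edges G'"
  proof -
    have "edges G \<subseteq> Pow U" "edges G' \<subseteq> Pow U"
      using G G' unfolding simple_graph_def by blast+
    with eq show ?thesis using inj_on_image_eq_iff[OF inj] by (simp add: map_graph_def)
  qed
  ultimately show "G = G'" by (simp add: prod_eq_iff)
qed

lemma graph_Union_map: "graph_Union (map_graph f ` C) = map_graph f (graph_Union C)"
  by (auto simp: graph_Union_def map_graph_def)

lemma verts_le_graph_Union: "F \<in> C \<Longrightarrow> verts F \<subseteq> verts (graph_Union C)"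
  by (auto simp: graph_Union_def)

lemma graph_Union_mono: "D \<subseteq> C \<Longrightarrow> subgraph (graph_Union D) (graph_Union C)"
  by (auto simp: graph_Union_def subgraph_def)

lemma finite_copies: "finite (copies H n)"
  by (rule finite_subset[of _ "Pow {1..n} \<times> Pow (Pow {1..n})"])
     (auto simp: copies_def subgraph_def complete_graph_def)

section \<open>Copies of \<open>H\<close> in the complete graph, with upper and lower bounds on
  their number\<close>

lemma map_graph_in_copies:
  assumes "simple_graph F" "isomorphic H F" "inj_on f (verts F)" "f ` verts F \<subseteq> {1..n}"
  shows "map_graph f F \<in> copies H n"
proof -
  have s: "simple_graph (map_graph f F)"
    using assms simple_graph_map by blast
  then have "edges (map_graph f F) \<subseteq> edges (complete_graph n)"
    using assms(4) unfolding simple_graph_def complete_graph_def verts_map_graph snd_conv by blast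
  then show ?thesis
    using s assms(4) isomorphic_map[OF assms(2,3)]
    by (simp add: copies_def subgraph_def complete_graph_def)
qed

text \<open>Every copy is the image of \<open>H\<close> under one of the
  \<open>n ^ card (verts H)\<close> extensional maps from \<open>verts H\<close> to
  \<open>{1..n}\<close>.\<close>

lemma card_copies_le:
  assumes "simple_graph H"
  shows "card (copies H n) \<le> n ^ card (verts H)"
proof -
  have "copies H n \<subseteq> (\<lambda>f. map_graph f H) ` (verts H \<rightarrow>\<^sub>E {1..n})"
  proof
    fix F assume F: "F \<in> copies H n"
    then obtain f where f: "bij_betw f (verts H) (verts F)" "edges F = (\<lambda>e. f ` e) ` edges H"
      by (auto simp: copies_def isomorphic_def)
    have "verts F \<subseteq> {1..n}"
      using F by (simp add: copies_def subgraph_def complete_graph_def)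
    then have "restrict f (verts H) \<in> verts H \<rightarrow>\<^sub>E {1..n}"
      using f(1) by (auto simp: bij_betw_def)
    moreover have "F = map_graph (restrict f (verts H)) H"
    proof -
      \<comment> \<open>The restriction outside \<open>verts H\<close> is harmless because edges of
        the simple graph \<open>H\<close> stay inside \<open>verts H\<close>.\<close>
      have "f ` e = restrict f (verts H) ` e" if "e \<in> edges H" for e
        using that assms unfolding simple_graph_def by (intro image_cong) auto
      then have "edges F = (`) (restrict f (verts H)) ` edges H"
        unfolding f(2) by (rule image_cong[OF refl])
      moreover have "verts F = restrict f (verts H) ` verts H"
        using f(1) by (simp add: bij_betw_def)
      ultimately show ?thesis by (simp add: map_graph_def prod_eq_iff)
    qed
    ultimately show "F \<in> (\<lambda>f. map_graph f H) ` (verts H \<rightarrow>\<^sub>E {1..n})" by blast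
  qed
  moreover have "finite (verts H)" using assms by (simp add: simple_graph_def)
  ultimately show ?thesis
    using surj_card_le[of "verts H \<rightarrow>\<^sub>E {1..n}" "copies H n"]
    by (simp add: finite_PiE card_PiE)
qed

text \<open>Each subset of \<open>{1..n}\<close> of the right size is the vertex set of some copy,
  so \<open>verts\<close> maps the copies onto these subsets.\<close>

lemma binomial_le_card_copies:
  assumes "simple_graph H"
  shows "n choose card (verts H) \<le> card (copies H n)"
proof -
  have fin: "finite (verts H)" using assms by (simp add: simple_graph_def)
  have "{A. A \<subseteq> {1..n} \<and> card A = card (verts H)} \<subseteq> verts ` copies H n"
  proof safe
    fix A assume A: "A \<subseteq> {1..n}" "card A = card (verts H)"
    then obtain f where f: "bij_betw f (verts H) A"
      using fin finite_same_card_bij[of "verts H" A] finite_subset by fastforce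
    have "isomorphic H H" unfolding isomorphic_def by (auto intro!: exI[of _ id])
    then have "map_graph f H \<in> copies H n"
      using assms A f by (intro map_graph_in_copies) (auto simp: bij_betw_def)
    moreover have "verts (map_graph f H) = A" using f by (simp add: bij_betw_def)
    ultimately show "A \<in> verts ` copies H n" by blast
  qed
  from surj_card_le[OF finite_copies this] show ?thesis
    using n_subsets[of "{1..n}" "card (verts H)"] by simp
qed

lemma binomial_le_card_inj:
  assumes "finite V"
  shows "n choose card V \<le> card {\<phi> \<in> V \<rightarrow>\<^sub>E {1..n}. inj_on \<phi> V}"
proof -
  have "{A. A \<subseteq> {1..n} \<and> card A = card V} \<subseteq> (\<lambda>\<phi>. \<phi> ` V) ` {\<phi> \<in> V \<rightarrow>\<^sub>E {1..n}. inj_on \<phi> V}"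
  proof safe
    fix A assume A: "A \<subseteq> {1..n}" "card A = card V"
    then obtain f where f: "bij_betw f V A"
      using assms finite_same_card_bij[of V A] finite_subset by fastforce
    have "restrict f V \<in> {\<phi> \<in> V \<rightarrow>\<^sub>E {1..n}. inj_on \<phi> V}"
      using f A by (auto simp: bij_betw_def inj_on_def)
    moreover have "A = restrict f V ` V" using f by (simp add: bij_betw_def)
    ultimately show "A \<in> (\<lambda>\<phi>. \<phi> ` V) ` {\<phi> \<in> V \<rightarrow>\<^sub>E {1..n}. inj_on \<phi> V}" by blast
  qed
  moreover have "finite {\<phi> \<in> V \<rightarrow>\<^sub>E {1..n}. inj_on \<phi> V}"
    using assms by (simp add: finite_PiE)
  ultimately show ?thesis
    using surj_card_le n_subsets[of "{1..n}" "card V"] by fastforce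
qed

section \<open>Random subsets of fixed size\<close>

text \<open>The probability that a uniformly random \<open>m\<close>-subset of an \<open>N\<close>-set contains a given \<open>k\<close>-subset.
  For \<open>k > m\<close> the factor \<open>i = m\<close> vanishes, so the value is correctly 0.\<close>

definition hit_prob :: "nat \<Rightarrow> nat \<Rightarrow> nat \<Rightarrow> real" where
  "hit_prob N m k = (\<Prod>i<k. (real m - real i) / (real N - real i))"

lemma card_supersets:
  assumes "finite A" "T \<subseteq> A" "card T \<le> m"
  shows "card {X. X \<subseteq> A \<and> card X = m \<and> T \<subseteq> X} = (card A - card T) choose (m - card T)"
proof -
  have finT: "finite T" using assms finite_subset by blast
  have "bij_betw (\<lambda>Y. Y \<union> T) {Y. Y \<subseteq> A - T \<and> card Y = m - card T}
      {X. X \<subseteq> A \<and> card X = m \<and> T \<subseteq> X}"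
  proof (rule bij_betw_byWitness[where f' = "\<lambda>X. X - T"])
    show "(\<lambda>Y. Y \<union> T) ` {Y. Y \<subseteq> A - T \<and> card Y = m - card T}
        \<subseteq> {X. X \<subseteq> A \<and> card X = m \<and> T \<subseteq> X}"
    proof clarify
      fix Y assume Y: "Y \<subseteq> A - T" "card Y = m - card T"
      then have "card (Y \<union> T) = card Y + card T"
        using assms finT by (intro card_Un_disjoint) (auto intro: finite_subset)
      then show "Y \<union> T \<subseteq> A \<and> card (Y \<union> T) = m \<and> T \<subseteq> Y \<union> T"
        using Y assms by auto
    qed
    show "(\<lambda>X. X - T) ` {X. X \<subseteq> A \<and> card X = m \<and> T \<subseteq> X}
        \<subseteq> {Y. Y \<subseteq> A - T \<and> card Y = m - card T}"
      using finT by (auto simp: card_Diff_subset)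
  qed auto
  then have "card {X. X \<subseteq> A \<and> card X = m \<and> T \<subseteq> X} =
      card {Y. Y \<subseteq> A - T \<and> card Y = m - card T}"
    by (simp add: bij_betw_same_card)
  also have "\<dots> = card (A - T) choose (m - card T)"
    using assms by (intro n_subsets) auto
  finally show ?thesis using assms finT by (simp add: card_Diff_subset)
qed

text \<open>The absorption identity for binomial coefficients supplies one factor of
  \<open>hit_prob\<close> in each induction step.\<close>

lemma binomial_hit_prob:
  assumes "k \<le> m" "m \<le> N"
  shows "real ((N - k) choose (m - k)) = hit_prob N m k * real (N choose m)"
  using assms(1)
proof (induction k)
  case 0
  then show ?case by (simp add: hit_prob_def)
next
  case (Suc k)
  obtain N' m' where e: "N - k = Suc N'" "m - k = Suc m'"
    using Suc.prems assms(2) by (metis Suc_diff_le Suc_le_lessD diff_Suc_Suc le_trans less_imp_Suc_add Suc_diff_Suc le_imp_less_Suc less_Suc_eq_le order_less_le_trans)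
  have e': "N - Suc k = N'" "m - Suc k = m'" using e by auto
  have "real (Suc N') * real (N' choose m') = real (Suc N' choose Suc m') * real (Suc m')"
    by (metis Suc_times_binomial_eq of_nat_mult)
  then have "real (N' choose m') = real (Suc m') / real (Suc N') * real (Suc N' choose Suc m')"
    by (simp add: field_simps)
  also have "real (Suc m') = real m - real k" using e Suc.prems by linarith
  also have "real (Suc N') = real N - real k" using e by linarith
  finally show ?case using Suc e e' by (simp add: hit_prob_def)
qed

text \<open>If \<open>card T > m\<close>, no \<open>m\<close>-set contains \<open>T\<close> and the
  product has a zero factor; so the formula holds for \<open>T\<close> of any size.\<close>

lemma card_supersets_hit_prob:
  assumes "finite A" "T \<subseteq> A" "m \<le> card A"
  shows "real (card {X. X \<subseteq> A \<and> card X = m \<and> T \<subseteq> X}) =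
    hit_prob (card A) m (card T) * real (card A choose m)"
proof (cases "card T \<le> m")
  case True
  then show ?thesis using assms by (simp add: card_supersets binomial_hit_prob)
next
  case False
  have "{X. X \<subseteq> A \<and> card X = m \<and> T \<subseteq> X} = {}"
    using False assms by (auto dest: card_mono[rotated] finite_subset)
  moreover have "hit_prob (card A) m (card T) = 0"
    using False by (auto simp: hit_prob_def intro!: bexI[of _ m])
  ultimately show ?thesis by (metis card.empty mult_zero_left of_nat_0)
qed

lemma hit_prob_nonneg:
  assumes "m \<le> N"
  shows "0 \<le> hit_prob N m k"
proof (cases "k \<le> m")
  case True
  then show ?thesis unfolding hit_prob_def using assms
    by (intro prod_nonneg) (auto intro!: divide_nonneg_nonneg)
next
  case False
  then have "hit_prob N m k = 0"
    by (auto simp: hit_prob_def intro!: bexI[of _ m])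
  then show ?thesis by simp
qed

text \<open>Subtracting the same \<open>i\<close> from numerator and denominator does not increase a
  fraction that is at most 1. For \<open>k > m\<close> later factors may be negative and the
  factorwise comparison breaks down; there the whole product is 0.\<close>

lemma hit_prob_le:
  assumes "m \<le> N"
  shows "hit_prob N m k \<le> (real m / real N) ^ k"
proof (cases "k \<le> m")
  case True
  have "hit_prob N m k \<le> (\<Prod>i<k. real m / real N)"
    unfolding hit_prob_def
  proof (intro prod_mono conjI)
    fix i assume "i \<in> {..<k}"
    then have i: "i < m" using True by simp
    then have "real i * real m \<le> real i * real N" using assms by (intro mult_left_mono) auto
    then show "(real m - real i) / (real N - real i) \<le> real m / real N"
      using i assms by (simp add: field_simps)
    show "0 \<le> (real m - real i) / (real N - real i)"
      using i assms by simp
  qed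
  then show ?thesis by simp
next
  case False
  then have "hit_prob N m k = 0"
    by (auto simp: hit_prob_def intro!: bexI[of _ m])
  then show ?thesis by simp
qed

text \<open>For \<open>i < k\<close> the bound \<open>2 * k \<le> m\<close> gives
  \<open>m - i \<ge> m / 2\<close>, while \<open>N - i \<le> N\<close>.\<close>

lemma hit_prob_ge:
  assumes "m \<le> N" "2 * k \<le> m"
  shows "(real m / (2 * real N)) ^ k \<le> hit_prob N m k"
proof -
  have "(\<Prod>i<k. real m / (2 * real N)) \<le> hit_prob N m k"
    unfolding hit_prob_def
  proof (intro prod_mono conjI)
    fix i assume "i \<in> {..<k}"
    then have i: "2 * i < m" using assms by simp
    have "real m / (2 * real N) = (real m / 2) / real N" by simp
    also have "\<dots> \<le> (real m - real i) / (real N - real i)"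
      using i assms by (intro frac_le) auto
    finally show "real m / (2 * real N) \<le> (real m - real i) / (real N - real i)" .
  qed simp
  then show ?thesis by simp
qed

text \<open>This is the negative correlation of two disjoint families of size \<open>k\<close>: the
  factors with index \<open>k + i\<close> are at most those with index \<open>i\<close>.\<close>

lemma hit_prob_double:
  assumes "m \<le> N" "2 * k \<le> m"
  shows "hit_prob N m (2 * k) \<le> (hit_prob N m k)\<^sup>2"
proof -
  let ?r = "\<lambda>i. (real m - real i) / (real N - real i)"
  have "hit_prob N m (k + k) = hit_prob N m k * (\<Prod>i<k. ?r (k + i))"
    unfolding hit_prob_def lessThan_atLeast0
    by (simp add: prod.atLeastLessThan_concat[of 0 k "k + k", symmetric]
        prod.shift_bounds_nat_ivl[of _ 0 k k, simplified] add.commute)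
  also have "(\<Prod>i<k. ?r (k + i)) \<le> hit_prob N m k"
    unfolding hit_prob_def
  proof (intro prod_mono conjI)
    fix i assume "i \<in> {..<k}"
    then have i: "k + i < m" using assms by simp
    show "0 \<le> ?r (k + i)" using i assms by simp
    have "real k * real m \<le> real k * real N" using assms by (intro mult_left_mono) auto
    then show "?r (k + i) \<le> ?r i"
      using i assms by (simp add: field_simps)
  qed
  finally show ?thesis
    using hit_prob_nonneg[OF assms(1), of k]
    by (simp add: mult_2 power2_eq_square mult_left_mono)
qed

text \<open>The bound on \<open>m\<close> makes the sample space nonempty, so that
  \<open>pmf_of_set\<close> is the uniform distribution. All later estimates are counts of
  \<open>m\<close>-subsets of \<open>copies H n\<close>.\<close>

lemma prob_motif_graph:
  assumes "m \<le> card (copies H n)"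
  shows "measure_pmf.prob (motif_graph H n m) {G. P G} =
    real (card {\<F>. \<F> \<subseteq> copies H n \<and> card \<F> = m \<and> P (graph_Union \<F>)}) /
    real (card (copies H n) choose m)"
proof -
  let ?\<Omega> = "{\<F>. \<F> \<subseteq> copies H n \<and> card \<F> = m}"
  have c: "card ?\<Omega> = card (copies H n) choose m"
    by (rule n_subsets[OF finite_copies])
  then have "?\<Omega> \<noteq> {}" using assms by (metis binomial_eq_0_iff card.empty not_le)
  moreover have "finite ?\<Omega>"
    by (rule finite_subset[of _ "Pow (copies H n)"]) (auto simp: finite_copies)
  moreover have "?\<Omega> \<inter> graph_Union -` {G. P G} =
      {\<F>. \<F> \<subseteq> copies H n \<and> card \<F> = m \<and> P (graph_Union \<F>)}" by auto
  ultimately show ?thesis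
    unfolding motif_graph_def measure_map_pmf by (simp add: measure_pmf_of_set c)
qed

section \<open>Minimal covers\<close>

lemma copies_simple: "F \<in> copies H n \<Longrightarrow> simple_graph F"
  and copies_isomorphic: "F \<in> copies H n \<Longrightarrow> isomorphic H F"
  and copies_verts: "F \<in> copies H n \<Longrightarrow> verts F \<subseteq> {1..n}"
  by (auto simp: copies_def subgraph_def complete_graph_def)

text \<open>One member of the family for each vertex and each edge of \<open>F\<close> gives a cover
  within the size bound. A cover of least cardinality obeys the same bound, and it cannot lose a
  member.\<close>

lemma minimal_subcover:
  assumes "subgraph F (graph_Union \<F>)" "simple_graph F"
  obtains C where "C \<subseteq> \<F>" "finite C" "card C \<le> card (verts F) + card (edges F)"
    "subgraph F (graph_Union C)" "\<And>G. G \<in> C \<Longrightarrow> \<not> subgraph F (graph_Union (C - {G}))"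
proof -
  have finV: "finite (verts F)" using assms by (simp add: simple_graph_def)
  have finE: "finite (edges F)"
    by (rule finite_subset[of _ "Pow (verts F)"]) (use assms in \<open>auto simp: simple_graph_def\<close>)
  have "\<forall>x\<in>verts F. \<exists>G\<in>\<F>. x \<in> verts G" "\<forall>e\<in>edges F. \<exists>G\<in>\<F>. e \<in> edges G"
    using assms(1) by (auto simp: subgraph_def graph_Union_def)
  then obtain g h where g: "\<And>x. x \<in> verts F \<Longrightarrow> g x \<in> \<F> \<and> x \<in> verts (g x)"
    and h: "\<And>e. e \<in> edges F \<Longrightarrow> h e \<in> \<F> \<and> e \<in> edges (h e)" by metis
  define C0 where "C0 = g ` verts F \<union> h ` edges F"
  \<comment> \<open>Finiteness is demanded explicitly since \<open>\<F>\<close> may be infinite and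
    \<open>card\<close> is 0 on infinite sets.\<close>
  define P where "P C \<longleftrightarrow> C \<subseteq> \<F> \<and> finite C \<and> subgraph F (graph_Union C)" for C
  have "P C0"
    unfolding P_def C0_def subgraph_def graph_Union_def using g h finV finE by fastforce
  then obtain C where C: "P C" and min: "\<And>C'. P C' \<Longrightarrow> card C \<le> card C'"
    using ex_has_least_nat[of P C0 card] by blast
  have "card C \<le> card C0" by (rule min[OF \<open>P C0\<close>])
  also have "\<dots> \<le> card (verts F) + card (edges F)"
    unfolding C0_def using card_Un_le[of "g ` verts F" "h ` edges F"]
      card_image_le[OF finV, of g] card_image_le[OF finE, of h] by linarith
  finally have "card C \<le> card (verts F) + card (edges F)" .
  moreover have "\<not> subgraph F (graph_Union (C - {G}))" if G: "G \<in> C" for G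
  proof
    assume "subgraph F (graph_Union (C - {G}))"
    then have "P (C - {G})" using C by (auto simp: P_def)
    from min[OF this] show False
      using G C card_Diff1_less[of C G] by (auto simp: P_def)
  qed
  ultimately show ?thesis using C that by (auto simp: P_def)
qed

lemma subgraph_map_iff:
  assumes "inj_on f U" "verts G \<subseteq> U" "verts F \<subseteq> U" "edges G \<subseteq> Pow U" "edges F \<subseteq> Pow U"
  shows "subgraph (map_graph f F) (map_graph f G) \<longleftrightarrow> subgraph F G"
  using assms inj_on_image_subset_iff[OF assms(1), of "verts F" "verts G"]
    inj_on_image_subset_iff[OF inj_on_image_Pow[OF assms(1)], of "edges F" "edges G"]
  by (simp add: subgraph_def)

lemma graph_Union_within:
  assumes "\<forall>F\<in>C. simple_graph F \<and> verts F \<subseteq> U"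
  shows "verts (graph_Union C) \<subseteq> U" "edges (graph_Union C) \<subseteq> Pow U"
  using assms by (fastforce simp: graph_Union_def simple_graph_def)+

lemma finite_graph_Union:
  "finite C \<Longrightarrow> \<forall>F\<in>C. simple_graph F \<Longrightarrow> finite (verts (graph_Union C))"
  by (auto simp: graph_Union_def simple_graph_def)

text \<open>An injection preserves and reflects inclusion of \<open>T\<close> in the union of any
  subfamily. Applied to \<open>C\<close> this transports the cover, applied to
  \<open>C - {F}\<close> its minimality.\<close>

lemma covering_map:
  assumes cov: "finite C" "\<forall>F\<in>C. simple_graph F \<and> isomorphic H F"
    "subgraph T (graph_Union C)" "\<forall>F\<in>C. \<not> subgraph T (graph_Union (C - {F}))"
    and T: "simple_graph T"
    and inj: "inj_on g (verts (graph_Union C))"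
  shows "covering H (map_graph g T) (card (verts (graph_Union C))) (card C) (map_graph g ` C)"
proof -
  let ?U = "verts (graph_Union C)"
  have within: "\<forall>F\<in>C. simple_graph F \<and> verts F \<subseteq> ?U"
    using cov(2) verts_le_graph_Union by blast
  have injC: "inj_on (map_graph g) C"
    using inj_on_subset[OF inj_on_map_graph[OF inj]] within by blast
  have TU: "verts T \<subseteq> ?U" using cov(3) by (simp add: subgraph_def)
  have TE: "edges T \<subseteq> Pow ?U" using T TU unfolding simple_graph_def by blast
  have sub: "subgraph (map_graph g T) (graph_Union (map_graph g ` D)) \<longleftrightarrow> subgraph T (graph_Union D)"
    if "D \<subseteq> C" for D
    unfolding graph_Union_map
    using graph_Union_within[of D ?U] within that TU TE by (intro subgraph_map_iff[OF inj]) auto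
  have "\<not> subgraph (map_graph g T) (graph_Union (map_graph g ` C - {map_graph g F}))"
    if "F \<in> C" for F
  proof -
    \<comment> \<open>Deleting a member commutes with taking images because
      \<open>map_graph g\<close> is injective on \<open>C\<close>.\<close>
    have "map_graph g ` C - {map_graph g F} = map_graph g ` (C - {F})"
      using injC that by (auto simp: inj_on_def)
    then show ?thesis using sub[of "C - {F}"] cov(4) that by auto
  qed
  moreover have "simple_graph (map_graph g F) \<and> isomorphic H (map_graph g F)" if "F \<in> C" for F
    using that within cov(2) by (auto intro!: simple_graph_map isomorphic_map inj_on_subset[OF inj])
  ultimately show ?thesis
    unfolding covering_def using cov(1) sub[of C] cov(3) card_image[OF injC] inj
    by (auto simp: graph_Union_map card_image)
qed

section \<open>The minimum \<open>gamma\<close> over subfamilies, and transport of covers\<close>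

lemma gamma_le:
  assumes "finite C" "D \<subseteq> C" "D \<noteq> {}"
  shows "gamma C * real (card D) \<le> real (card (verts (graph_Union D)))"
proof -
  have D: "finite D" "card D > 0" using assms finite_subset by (auto simp: card_gt_0_iff)
  have "gamma C \<le> real (card (verts (graph_Union D))) / real (card D)"
    unfolding gamma_def
  proof (intro Min_le finite_gamma_values assms)
    have "cover_subset C (card (verts (graph_Union D))) (card D) D"
      using assms D by (simp add: cover_subset_def Suc_le_eq)
    then show "real (card (verts (graph_Union D))) / real (card D)
        \<in> {real a' / real b' |a' b'. \<exists>D. cover_subset C a' b' D}" by blast
  qed
  then show ?thesis using D by (simp add: field_simps)
qed

text \<open>A singleton subfamily shows that the \<open>Min\<close> is over a nonempty set. The
  minimizer is the sparse subfamily counted in the first moment bound.\<close>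

lemma gamma_attained:
  assumes "finite C" "C \<noteq> {}"
  obtains D where "D \<subseteq> C" "D \<noteq> {}"
    "gamma C * real (card D) = real (card (verts (graph_Union D)))"
proof -
  obtain F where "F \<in> C" using assms by blast
  then have "cover_subset C (card (verts (graph_Union {F}))) 1 {F}"
    by (auto simp: cover_subset_def)
  then have "gamma C \<in> {real a' / real b' |a' b'. \<exists>D. cover_subset C a' b' D}"
    unfolding gamma_def by (intro Min_in finite_gamma_values assms) blast
  then obtain D where D: "D \<subseteq> C" "1 \<le> card D"
    "gamma C = real (card (verts (graph_Union D))) / real (card D)"
    by (auto simp: cover_subset_def)
  then have "D \<noteq> {}" by auto
  with D show ?thesis using that[of D] by simp
qed

lemma gamma_le_gamma_bar:
  fixes S :: "'s::infinite ugraph"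
  assumes "simple_graph S" "verts S \<noteq> {}" "covering H S a b C"
  shows "gamma C \<le> gamma_bar S H"
  unfolding gamma_bar_def using assms by (intro Max_ge finite_gamma_bar_values) auto

lemma extend_injection:
  fixes f :: "'a \<Rightarrow> 's::infinite"
  assumes "finite U" "V \<subseteq> U" "inj_on f V"
  obtains g where "inj_on g U" "\<And>x. x \<in> V \<Longrightarrow> g x = f x"
proof -
  have "finite (f ` V)" using assms finite_subset by blast
  then have "infinite (UNIV - f ` V)" using infinite_UNIV by (rule Diff_infinite_finite)
  then obtain B where B: "B \<subseteq> UNIV - f ` V" "finite B" "card B = card (U - V)"
    using infinite_arbitrarily_large by metis
  then obtain h where h: "bij_betw h (U - V) B"
    using finite_same_card_bij[of "U - V" B] assms by auto
  define g where "g x = (if x \<in> V then f x else h x)" for x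
  have "inj_on g V" using assms(3) by (auto simp: g_def inj_on_def)
  moreover have "inj_on g (U - V)" using h by (auto simp: g_def bij_betw_def inj_on_def)
  moreover have "g ` V \<inter> g ` (U - V) = {}" using h B by (auto simp: g_def bij_betw_def)
  ultimately have "inj_on g (V \<union> (U - V))" unfolding inj_on_Un by blast
  moreover have "V \<union> (U - V) = U" using assms by auto
  ultimately have "inj_on g U" by simp
  then show ?thesis using that[of g] by (auto simp: g_def)
qed

text \<open>A minimal cover of the copy \<open>T\<close> of \<open>S\<close> is carried to a
  covering of \<open>S\<close>, where \<open>gamma\<close> is at most \<open>gamma_bar S H\<close>.
  The subfamily attaining \<open>gamma\<close> is then carried back, with the same number of copies
  and of vertices.\<close>

lemma contains_copy_sparse_subfamily:
  fixes S :: "'s::infinite ugraph"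
  assumes S: "simple_graph S" "verts S \<noteq> {}"
    and \<F>: "\<F> \<subseteq> copies H n" "contains_copy (graph_Union \<F>) S"
  obtains D where "D \<subseteq> \<F>" "D \<noteq> {}" "card D \<le> card (verts S) + card (edges S)"
    "real (card (verts (graph_Union D))) \<le> gamma_bar S H * real (card D)"
proof -
  obtain T where T: "simple_graph T" "subgraph T (graph_Union \<F>)" "isomorphic S T"
    using \<F>(2) by (auto simp: contains_copy_def)
  obtain f where f: "bij_betw f (verts S) (verts T)" "edges T = (\<lambda>e. f ` e) ` edges S"
    using T(3) by (auto simp: isomorphic_def)
  have finES: "finite (edges S)"
    by (rule finite_subset[of _ "Pow (verts S)"]) (use S in \<open>auto simp: simple_graph_def\<close>)
  have card_T: "card (verts T) = card (verts S)" "card (edges T) \<le> card (edges S)"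
    using f bij_betw_same_card card_image_le[OF finES] by force+
  obtain C where C: "C \<subseteq> \<F>" "finite C" "card C \<le> card (verts T) + card (edges T)"
    "subgraph T (graph_Union C)" "\<And>G. G \<in> C \<Longrightarrow> \<not> subgraph T (graph_Union (C - {G}))"
    using minimal_subcover[OF T(2,1)] by metis
  let ?U = "verts (graph_Union C)"
  have simC: "\<forall>F\<in>C. simple_graph F \<and> isomorphic H F"
    using C(1) \<F>(1) copies_simple copies_isomorphic by blast
  have TU: "verts T \<subseteq> ?U" using C(4) by (simp add: subgraph_def)
  \<comment> \<open>Extending the inverse of the isomorphism sends \<open>T\<close> to
    \<open>S\<close> itself and not just to an isomorphic graph, as \<open>covering\<close> uses
    plain inclusion.\<close>
  define f' where "f' = inv_into (verts S) f"
  have f': "bij_betw f' (verts T) (verts S)"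
    unfolding f'_def by (rule bij_betw_inv_into[OF f(1)])
  obtain g where g: "inj_on g ?U" "\<And>x. x \<in> verts T \<Longrightarrow> g x = f' x"
    using extend_injection[OF finite_graph_Union[OF C(2)] TU bij_betw_imp_inj_on[OF f']] simC
    by blast
  have gf: "g (f x) = x" if "x \<in> verts S" for x
  proof -
    have "f x \<in> verts T" using that f(1) by (auto simp: bij_betw_def)
    then show ?thesis using that f(1) g(2) by (simp add: f'_def bij_betw_inv_into_left)
  qed
  have "verts (map_graph g T) = verts S"
    using f(1) gf by (force simp: bij_betw_def)
  moreover have "edges (map_graph g T) = edges S"
  proof -
    have "g ` f ` e = e" if "e \<in> edges S" for e
    proof -
      have "e \<subseteq> verts S" using that S by (auto simp: simple_graph_def)
      then have "g ` f ` e = id ` e" unfolding image_image by (intro image_cong) (auto simp: gf)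
      then show ?thesis by simp
    qed
    then show ?thesis by (simp add: f(2) image_image)
  qed
  ultimately have "map_graph g T = S" by (simp add: prod_eq_iff)
  then have cov: "covering H S (card ?U) (card C) (map_graph g ` C)"
    using covering_map[OF C(2) simC C(4) _ T(1) g(1)] C(5) by auto
  have "C \<noteq> {}" using C(4) card_T S T(1) by (auto simp: subgraph_def graph_Union_def simple_graph_def)
  then obtain D' where D': "D' \<subseteq> map_graph g ` C" "D' \<noteq> {}"
    "gamma (map_graph g ` C) * real (card D') = real (card (verts (graph_Union D')))"
    using gamma_attained[of "map_graph g ` C"] C(2) by auto
  then obtain D where D: "D \<subseteq> C" "D' = map_graph g ` D" unfolding subset_image_iff by metis
  have "D \<subseteq> {G. simple_graph G \<and> verts G \<subseteq> ?U}"
  proof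
    fix F assume "F \<in> D"
    then have "F \<in> C" using D(1) by (rule subsetD[rotated])
    then show "F \<in> {G. simple_graph G \<and> verts G \<subseteq> ?U}"
      using simC verts_le_graph_Union[of F C] by simp
  qed
  then have "inj_on (map_graph g) D" by (rule inj_on_subset[OF inj_on_map_graph[OF g(1)]])
  then have cD: "card D' = card D" using D by (simp add: card_image)
  have "inj_on g (verts (graph_Union D))"
    using inj_on_subset[OF g(1)] graph_Union_mono[OF D(1)] by (simp add: subgraph_def)
  then have vD: "card (verts (graph_Union D')) = card (verts (graph_Union D))"
    using D by (simp add: graph_Union_map card_image)
  show ?thesis
  proof (rule that[of D])
    show "D \<subseteq> \<F>" "D \<noteq> {}" using D C(1) D'(2) by auto
    show "card D \<le> card (verts S) + card (edges S)"
      using card_mono[OF C(2) D(1)] C(3) card_T by linarith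
    have "real (card (verts (graph_Union D))) = gamma (map_graph g ` C) * real (card D)"
      using D'(3) cD vD by simp
    also have "\<dots> \<le> gamma_bar S H * real (card D)"
      by (intro mult_right_mono gamma_le_gamma_bar[OF S cov]) simp
    finally show "real (card (verts (graph_Union D))) \<le> gamma_bar S H * real (card D)" .
  qed
qed

text \<open>The maximum is over a finite set, so it remains to find one covering. As
  \<open>H\<close> has an edge, any two distinct points of the ground type are joined in some copy
  of \<open>H\<close>; all copies together contain \<open>S\<close>, and
  \<open>minimal_subcover\<close> extracts a covering.\<close>

lemma gamma_bar_attained:
  fixes S :: "'s::infinite ugraph" and H :: "'h ugraph"
  assumes H: "simple_graph H" "verts H \<noteq> {}" "no_isolated H"
    and S: "simple_graph S" "verts S \<noteq> {}"
  obtains C a b where "covering H S a b C" "gamma C = gamma_bar S H"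
proof -
  have finH: "finite (verts H)" using H by (simp add: simple_graph_def)
  obtain u w where uw: "{u, w} \<in> edges H" "u \<noteq> w" "u \<in> verts H" "w \<in> verts H"
  proof -
    obtain e where "e \<in> edges H" using H(2,3) unfolding no_isolated_def by blast
    then have "card e = 2" "e \<subseteq> verts H" using H(1) by (auto simp: simple_graph_def)
    then obtain u w where "e = {u, w}" "u \<noteq> w" by (auto simp: card_2_iff)
    then show ?thesis using that \<open>e \<in> edges H\<close> \<open>e \<subseteq> verts H\<close> by auto
  qed
  define \<F> :: "'s ugraph set" where "\<F> = {F. simple_graph F \<and> isomorphic H F}"
  have cov2: "\<exists>F\<in>\<F>. {x, y} \<in> edges F \<and> x \<in> verts F" if "x \<noteq> y" for x y :: 's
  proof -
    have "inj_on (\<lambda>z. if z = u then x else y) {u, w}" using that uw by (auto simp: inj_on_def)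
    moreover have "{u, w} \<subseteq> verts H" using uw by simp
    ultimately obtain g where g: "inj_on g (verts H)"
      "\<And>z. z \<in> {u, w} \<Longrightarrow> g z = (if z = u then x else y)"
      using extend_injection[OF finH, of "{u, w}" "\<lambda>z. if z = u then x else y"] by blast
    then have "g u = x" "g w = y" using uw by auto
    then have "{x, y} = g ` {u, w}" "x \<in> g ` verts H" using uw by auto
    then have "{x, y} \<in> edges (map_graph g H)" "x \<in> verts (map_graph g H)"
      using uw(1) by (simp_all only: edges_map_graph verts_map_graph imageI)
    moreover have "map_graph g H \<in> \<F>"
      using simple_graph_map[OF H(1) g(1)] isomorphic_map_graph_self[OF g(1)] by (simp add: \<F>_def)
    ultimately show ?thesis by blast
  qed
  have "subgraph S (graph_Union \<F>)"
    unfolding subgraph_def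
  proof safe
    fix x assume "x \<in> verts S"
    \<comment> \<open>An arbitrary second point serves, so vertices of \<open>S\<close> without
      edges are reached as well.\<close>
    obtain y where "y \<noteq> x" using ex_new_if_finite[OF infinite_UNIV, of "{x}"] by blast
    then show "x \<in> verts (graph_Union \<F>)" using cov2[of x y] by (auto simp: graph_Union_def)
  next
    fix e assume "e \<in> edges S"
    then have "card e = 2" using S by (auto simp: simple_graph_def)
    then obtain x y where "e = {x, y}" "x \<noteq> y" by (auto simp: card_2_iff)
    then show "e \<in> edges (graph_Union \<F>)" using cov2[of x y] by (auto simp: graph_Union_def)
  qed
  then obtain C where C: "C \<subseteq> \<F>" "finite C" "subgraph S (graph_Union C)"
    "\<And>G. G \<in> C \<Longrightarrow> \<not> subgraph S (graph_Union (C - {G}))"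
    using minimal_subcover[OF _ S(1)] by metis
  then have "covering H S (card (verts (graph_Union C))) (card C) C"
    by (auto simp: covering_def \<F>_def)
  then have "{gamma C |C. \<exists>a b. covering H S a b C} \<noteq> {}" by blast
  from Max_in[OF finite_gamma_bar_values[OF S] this] show ?thesis
    using that unfolding gamma_bar_def by (auto simp: eq_commute)
qed

section \<open>The sparse regime\<close>

text \<open>Union bound: if \<open>S\<close> occurs, some sparse \<open>D\<close> given by
  \<open>contains_copy_sparse_subfamily\<close> is chosen entirely, which has probability at most
  \<open>p ^ card D\<close> by \<open>hit_prob_le\<close>, with \<open>p\<close> the ratio of
  \<open>m\<close> to the number of copies.\<close>

lemma prob_contains_copy_le:
  fixes S :: "'s::infinite ugraph"
  assumes S: "simple_graph S" "verts S \<noteq> {}" and m: "m \<le> card (copies H n)"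
  shows "measure_pmf.prob (motif_graph H n m) {G. contains_copy G S} \<le>
    (\<Sum>D | D \<subseteq> copies H n \<and> D \<noteq> {} \<and> card D \<le> card (verts S) + card (edges S) \<and>
        real (card (verts (graph_Union D))) \<le> gamma_bar S H * real (card D).
      (real m / real (card (copies H n))) ^ card D)" (is "_ \<le> sum _ ?\<D>")
proof -
  define N where "N = card (copies H n)"
  let ?\<Omega> = "{\<F>. \<F> \<subseteq> copies H n \<and> card \<F> = m}"
  let ?E = "\<lambda>D. {\<F>. \<F> \<subseteq> copies H n \<and> card \<F> = m \<and> D \<subseteq> \<F>}"
  have fin\<D>: "finite ?\<D>"
    by (rule finite_subset[of _ "Pow (copies H n)"]) (auto simp: finite_copies)
  have finE: "finite (?E D)" for D
    by (rule finite_subset[of _ "Pow (copies H n)"]) (auto simp: finite_copies)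
  have pos: "real (N choose m) > 0" using m by (simp add: N_def)
  have "{\<F>. \<F> \<subseteq> copies H n \<and> card \<F> = m \<and> contains_copy (graph_Union \<F>) S} \<subseteq> (\<Union>D\<in>?\<D>. ?E D)"
  proof
    fix \<F> assume "\<F> \<in> {\<F>. \<F> \<subseteq> copies H n \<and> card \<F> = m \<and> contains_copy (graph_Union \<F>) S}"
    then have \<F>: "\<F> \<subseteq> copies H n" "contains_copy (graph_Union \<F>) S" "card \<F> = m" by simp_all
    from contains_copy_sparse_subfamily[OF S \<F>(1,2)] obtain D where D: "D \<subseteq> \<F>" "D \<noteq> {}"
      "card D \<le> card (verts S) + card (edges S)"
      "real (card (verts (graph_Union D))) \<le> gamma_bar S H * real (card D)" .
    have "D \<in> ?\<D>" using D subset_trans[OF D(1) \<F>(1)] by simp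
    moreover have "\<F> \<in> ?E D" using \<F> D(1) by simp
    ultimately show "\<F> \<in> (\<Union>D\<in>?\<D>. ?E D)" by (rule UN_I)
  qed
  then have "card {\<F>. \<F> \<subseteq> copies H n \<and> card \<F> = m \<and> contains_copy (graph_Union \<F>) S}
      \<le> card (\<Union>D\<in>?\<D>. ?E D)"
    by (rule card_mono[rotated]) (rule finite_UN_I[OF fin\<D> finE])
  also have "\<dots> \<le> (\<Sum>D\<in>?\<D>. card (?E D))" by (rule card_UN_le[OF fin\<D>])
  finally have "real (card {\<F>. \<F> \<subseteq> copies H n \<and> card \<F> = m \<and> contains_copy (graph_Union \<F>) S})
      \<le> (\<Sum>D\<in>?\<D>. real (card (?E D)))" by (simp only: of_nat_le_iff of_nat_sum[symmetric])
  also have "\<dots> = (\<Sum>D\<in>?\<D>. hit_prob N m (card D)) * real (N choose m)"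
    unfolding N_def sum_distrib_right
    by (intro sum.cong refl card_supersets_hit_prob[OF finite_copies _ m]) simp
  also have "\<dots> \<le> (\<Sum>D\<in>?\<D>. (real m / real N) ^ card D) * real (N choose m)"
    using m by (intro mult_right_mono sum_mono hit_prob_le) (auto simp: N_def)
  finally show ?thesis
    using pos by (simp add: prob_motif_graph[OF m] N_def divide_le_eq)
qed

text \<open>A fixed vertex set carries boundedly many families, and the at most \<open>n ^ j\<close>
  vertex sets of size \<open>j\<close> cancel the weight \<open>1 / n ^ j\<close>. Each of the sizes
  \<open>0, ..., a\<close> thus contributes a constant.\<close>

lemma sum_inverse_power_card_verts_le:
  fixes n a :: nat
  assumes "n \<ge> 1" "finite \<D>"
    and "\<And>D. D \<in> \<D> \<Longrightarrow> (\<forall>F\<in>D. simple_graph F) \<and> verts (graph_Union D) \<subseteq> {1..n} \<and>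
      card (verts (graph_Union D)) \<le> a"
  shows "(\<Sum>D\<in>\<D>. 1 / real n ^ card (verts (graph_Union D))) \<le> (real a + 1) * 2 ^ (2 ^ a * 2 ^ 2 ^ a)"
proof -
  \<comment> \<open>The number of all sets of pairs of a vertex set and an edge set over a ground
    set of \<open>a\<close> points.\<close>
  define K :: nat where "K = 2 ^ (2 ^ a * 2 ^ 2 ^ a)"
  let ?V = "\<lambda>D. verts (graph_Union D)"
  let ?\<U> = "{U. U \<subseteq> {1..n} \<and> card U \<le> a}"
  have fin: "finite ?\<U>" by (rule finite_subset[of _ "Pow {1..n}"]) auto
  have fibre: "card {D \<in> \<D>. ?V D = U} \<le> K" if U: "U \<in> ?\<U>" for U
  proof -
    have finU: "finite U" using U finite_subset[of U "{1..n}"] by simp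
    have "{D \<in> \<D>. ?V D = U} \<subseteq> Pow (Pow U \<times> Pow (Pow U))"
    proof (rule subsetI, rule PowI, rule subsetI)
      fix D F assume "D \<in> {D \<in> \<D>. ?V D = U}" and F: "F \<in> D"
      then have D: "D \<in> \<D>" "?V D = U" by simp_all
      have "verts F \<subseteq> U" using verts_le_graph_Union[OF F] D(2) by simp
      moreover have "simple_graph F" using assms(3)[OF D(1)] F by simp
      then have "edges F \<subseteq> Pow (verts F)" by (auto simp: simple_graph_def)
      ultimately show "F \<in> Pow U \<times> Pow (Pow U)" unfolding mem_Times_iff by auto
    qed
    then have "card {D \<in> \<D>. ?V D = U} \<le> card (Pow (Pow U \<times> Pow (Pow U)))"
      by (rule card_mono[rotated]) (simp add: finU)
    also have "\<dots> = 2 ^ (2 ^ card U * 2 ^ 2 ^ card U)"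
      using finU by (simp add: card_Pow card_cartesian_product)
    also have "\<dots> \<le> K" unfolding K_def using U by (intro power_increasing mult_mono) auto
    finally show ?thesis .
  qed
  have "(\<Sum>D\<in>\<D>. 1 / real n ^ card (?V D)) =
      (\<Sum>U\<in>?\<U>. \<Sum>D\<in>{D \<in> \<D>. ?V D = U}. 1 / real n ^ card (?V D))"
    by (rule sum.group[symmetric, OF assms(2) fin]) (use assms(3) in blast)
  also have "\<dots> = (\<Sum>U\<in>?\<U>. real (card {D \<in> \<D>. ?V D = U}) * (1 / real n ^ card U))"
    by (intro sum.cong refl) simp
  also have "\<dots> \<le> (\<Sum>U\<in>?\<U>. real K * (1 / real n ^ card U))"
    by (intro sum_mono mult_right_mono) (use fibre in auto)
  also have "\<dots> = (\<Sum>j\<in>{..a}. \<Sum>U\<in>{U \<in> ?\<U>. card U = j}. real K * (1 / real n ^ card U))"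
    by (rule sum.group[symmetric, OF fin]) auto
  also have "\<dots> \<le> (\<Sum>j\<in>{..a}. real K)"
  proof (intro sum_mono)
    fix j assume "j \<in> {..a}"
    then have e: "{U \<in> ?\<U>. card U = j} = {U. U \<subseteq> {1..n} \<and> card U = j}" by auto
    have "(\<Sum>U\<in>{U \<in> ?\<U>. card U = j}. real K * (1 / real n ^ card U)) =
        real (n choose j) * (real K * (1 / real n ^ j))"
      unfolding e using n_subsets[of "{1..n}" j] by simp
    also have "\<dots> \<le> real n ^ j * (real K * (1 / real n ^ j))"
    proof (intro mult_right_mono)
      show "real (n choose j) \<le> real n ^ j"
        using binomial_le_pow[of j n]
        by (cases "j \<le> n") (auto simp: binomial_eq_0 of_nat_power[symmetric] simp del: of_nat_power)
    qed simp
    also have "\<dots> = real K" using assms(1) by simp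
    finally show "(\<Sum>U\<in>{U \<in> ?\<U>. card U = j}. real K * (1 / real n ^ card U)) \<le> real K" .
  qed
  also have "\<dots> = (real a + 1) * real K" by simp
  finally show ?thesis by (simp add: K_def)
qed

lemma card_verts_graph_Union_le:
  assumes "\<forall>F\<in>D. isomorphic H F" "finite D"
  shows "card (verts (graph_Union D)) \<le> card D * card (verts H)"
proof -
  have "card (verts (graph_Union D)) \<le> (\<Sum>F\<in>D. card (verts F))"
    unfolding graph_Union_def using card_UN_le[OF assms(2)] by simp
  also have "\<dots> = (\<Sum>F\<in>D. card (verts H))"
    using assms(1) by (intro sum.cong refl isomorphic_card) auto
  finally show ?thesis by simp
qed

text \<open>With \<open>p \<le> K\<^sub>1 * \<epsilon> * n powr (- \<gamma>)\<close>, the sparsity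
  of \<open>D\<close> makes \<open>p ^ card D\<close> at most a constant times
  \<open>\<epsilon>\<close> times \<open>1 / n ^ a'\<close>, where \<open>a'\<close> is the number
  of vertices of \<open>D\<close>. The previous sum bound then applies.\<close>

lemma prob_contains_copy_small:
  fixes S :: "'s::infinite ugraph" and H :: "'h ugraph"
  assumes H: "simple_graph H" and S: "simple_graph S" "verts S \<noteq> {}"
  obtains K :: real where
    "\<And>n m \<epsilon>. \<lbrakk>m \<le> card (copies H n); n \<ge> card (verts H); n \<ge> 1; 0 < \<epsilon>; \<epsilon> \<le> 1;
       real m \<le> \<epsilon> * real n powr (real (card (verts H)) - gamma_bar S H)\<rbrakk>
     \<Longrightarrow> measure_pmf.prob (motif_graph H n m) {G. contains_copy G S} \<le> K * \<epsilon>" "0 < K"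
proof -
  define v where "v = card (verts H)"
  define B where "B = card (verts S) + card (edges S)"
  define \<gamma> where "\<gamma> = gamma_bar S H"
  \<comment> \<open>This absorbs the denominator in the bound \<open>(n / v) ^ v\<close> on the
    number of copies; the base \<open>v + 1\<close> is positive also for
    \<open>v = 0\<close>.\<close>
  define K\<^sub>1 :: real where "K\<^sub>1 = (real v + 1) ^ v"
  define K where "K = K\<^sub>1 ^ B * ((real (B * v) + 1) * 2 ^ (2 ^ (B * v) * 2 ^ 2 ^ (B * v)))"
  have K1: "K\<^sub>1 \<ge> 1" unfolding K\<^sub>1_def by simp
  have "measure_pmf.prob (motif_graph H n m) {G. contains_copy G S} \<le> K * \<epsilon>"
    if m: "m \<le> card (copies H n)" and n: "n \<ge> v" "n \<ge> 1" and \<epsilon>: "0 < \<epsilon>" "\<epsilon> \<le> 1"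
      and bound: "real m \<le> \<epsilon> * real n powr (real v - \<gamma>)" for n m \<epsilon>
  proof -
    define p where "p = real m / real (card (copies H n))"
    let ?\<D> = "{D. D \<subseteq> copies H n \<and> D \<noteq> {} \<and> card D \<le> B \<and>
        real (card (verts (graph_Union D))) \<le> \<gamma> * real (card D)}"
    have "(real n / real v) ^ v \<le> real (n choose v)"
      by (rule binomial_ge_n_over_k_pow_k[OF n(1)])
    also have "\<dots> \<le> real (card (copies H n))"
      using binomial_le_card_copies[OF H, of n] by (simp add: v_def)
    finally have "(real n / real v) ^ v \<le> real (card (copies H n))" .
    moreover have "real n ^ v / K\<^sub>1 \<le> (real n / real v) ^ v"
      unfolding K\<^sub>1_def power_divide
      by (cases "v = 0") (auto intro!: divide_left_mono power_mono mult_pos_pos)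
    ultimately have N: "real n ^ v / K\<^sub>1 \<le> real (card (copies H n))" by linarith
    have npos: "real n ^ v / K\<^sub>1 > 0" using n K1 by simp
    have "p \<le> (\<epsilon> * real n powr (real v - \<gamma>)) / (real n ^ v / K\<^sub>1)"
      unfolding p_def using bound N npos \<epsilon> by (intro frac_le) auto
    also have "\<dots> = K\<^sub>1 * \<epsilon> * real n powr (- \<gamma>)"
      using n by (simp add: powr_diff powr_minus_divide powr_realpow)
    finally have p: "p \<le> K\<^sub>1 * \<epsilon> * real n powr (- \<gamma>)" .
    have summand: "p ^ card D \<le> K\<^sub>1 ^ B * \<epsilon> * (1 / real n ^ card (verts (graph_Union D)))"
      if D: "D \<in> ?\<D>" for D
    proof -
      have "finite D" using D finite_subset[OF _ finite_copies, of D H n] by simp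
      then have cD: "1 \<le> card D" using D by (simp add: Suc_le_eq card_gt_0_iff)
      have "p ^ card D \<le> (K\<^sub>1 * \<epsilon> * real n powr (- \<gamma>)) ^ card D"
        using p by (intro power_mono) (auto simp: p_def)
      also have "\<dots> = K\<^sub>1 ^ card D * \<epsilon> ^ card D * real n powr (- \<gamma> * real (card D))"
        using n by (simp add: power_mult_distrib powr_power mult.commute)
      \<comment> \<open>Since \<open>D\<close> is nonempty, one factor
        \<open>\<epsilon> \<le> 1\<close> is kept. The exponent of \<open>n\<close> changes by
        \<open>a' \<le> \<gamma> * card D\<close>.\<close>
      also have "\<dots> \<le> K\<^sub>1 ^ B * \<epsilon> ^ 1 * real n powr (- real (card (verts (graph_Union D))))"
        using D n K1 \<epsilon> cD by (intro mult_mono power_increasing power_decreasing powr_mono) auto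
      also have "real n powr (- real (card (verts (graph_Union D)))) =
          1 / real n ^ card (verts (graph_Union D))"
        using n by (simp add: powr_minus powr_realpow divide_inverse)
      finally show ?thesis by simp
    qed
    have "measure_pmf.prob (motif_graph H n m) {G. contains_copy G S} \<le> (\<Sum>D\<in>?\<D>. p ^ card D)"
      using prob_contains_copy_le[OF S m] by (simp add: p_def B_def \<gamma>_def)
    also have "\<dots> \<le> (\<Sum>D\<in>?\<D>. K\<^sub>1 ^ B * \<epsilon> * (1 / real n ^ card (verts (graph_Union D))))"
      by (rule sum_mono[OF summand])
    also have "\<dots> = K\<^sub>1 ^ B * \<epsilon> * (\<Sum>D\<in>?\<D>. 1 / real n ^ card (verts (graph_Union D)))"
      by (simp add: sum_distrib_left)
    also have "\<dots> \<le> K\<^sub>1 ^ B * \<epsilon> * ((real (B * v) + 1) * 2 ^ (2 ^ (B * v) * 2 ^ 2 ^ (B * v)))"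
    proof (intro mult_left_mono sum_inverse_power_card_verts_le n)
      show "finite ?\<D>"
        by (rule finite_subset[of _ "Pow (copies H n)"]) (auto simp: finite_copies)
      fix D assume D: "D \<in> ?\<D>"
      then have "finite D" using finite_copies finite_subset by blast
      have "card (verts (graph_Union D)) \<le> card D * v"
        unfolding v_def
      proof (rule card_verts_graph_Union_le[OF _ \<open>finite D\<close>])
        show "\<forall>F\<in>D. isomorphic H F" using D copies_isomorphic[of _ H n] by blast
      qed
      also have "\<dots> \<le> B * v" using D by simp
      finally show "(\<forall>F\<in>D. simple_graph F) \<and> verts (graph_Union D) \<subseteq> {1..n} \<and>
          card (verts (graph_Union D)) \<le> B * v"
      proof (intro conjI)
        show "\<forall>F\<in>D. simple_graph F" using D copies_simple by blast
        have "verts F \<subseteq> {1..n}" if "F \<in> D" for F using D that copies_verts[of F] by blast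
        then show "verts (graph_Union D) \<subseteq> {1..n}" unfolding graph_Union_def fst_conv by (rule UN_least)
      qed
    qed (use K1 \<epsilon> in auto)
    also have "\<dots> = K * \<epsilon>" by (simp add: K_def)
    finally show ?thesis .
  qed
  moreover have "0 < K"
    unfolding K_def using K1 by (intro mult_pos_pos) (auto simp: add_nonneg_pos)
  ultimately show ?thesis using that[of K] by (simp add: v_def \<gamma>_def)
qed

section \<open>The dense regime\<close>

text \<open>Chebyshev's inequality in counting form: each point with \<open>X \<omega> = 0\<close>
  contributes \<open>\<mu>\<^sup>2\<close> to the sum of squared deviations.\<close>

lemma second_moment_finite:
  fixes X :: "'a \<Rightarrow> real"
  assumes "finite \<Omega>" "(\<Sum>\<omega>\<in>\<Omega>. X \<omega>) = \<mu> * real (card \<Omega>)"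
  shows "real (card {\<omega>\<in>\<Omega>. X \<omega> = 0}) * \<mu>\<^sup>2 \<le> (\<Sum>\<omega>\<in>\<Omega>. (X \<omega>)\<^sup>2) - real (card \<Omega>) * \<mu>\<^sup>2"
proof -
  have "real (card {\<omega>\<in>\<Omega>. X \<omega> = 0}) * \<mu>\<^sup>2 = (\<Sum>\<omega>\<in>{\<omega>\<in>\<Omega>. X \<omega> = 0}. (X \<omega> - \<mu>)\<^sup>2)"
    by simp
  also have "\<dots> \<le> (\<Sum>\<omega>\<in>\<Omega>. (X \<omega> - \<mu>)\<^sup>2)"
    using assms(1) by (intro sum_mono2) auto
  also have "\<dots> = (\<Sum>\<omega>\<in>\<Omega>. (X \<omega>)\<^sup>2 - 2 * \<mu> * X \<omega> + \<mu>\<^sup>2)"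
    by (simp add: power2_diff algebra_simps)
  also have "\<dots> = (\<Sum>\<omega>\<in>\<Omega>. (X \<omega>)\<^sup>2) - 2 * \<mu> * (\<Sum>\<omega>\<in>\<Omega>. X \<omega>) + real (card \<Omega>) * \<mu>\<^sup>2"
    by (simp add: sum.distrib sum_subtractf sum_distrib_left)
  also have "\<dots> = (\<Sum>\<omega>\<in>\<Omega>. (X \<omega>)\<^sup>2) - real (card \<Omega>) * \<mu>\<^sup>2"
    by (simp add: assms(2) power2_eq_square)
  finally show ?thesis .
qed

text \<open>The counting form of Chebyshev's inequality is applied to the number of indices
  \<open>i\<close> with \<open>T i \<subseteq> X\<close>. The sets are indexed because different
  injections may produce the same image of a covering.\<close>

lemma second_moment_supersets:
  fixes T :: "'i \<Rightarrow> 'a set"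
  assumes "finite A" "m \<le> card A" "finite I"
    and T: "\<And>i. i \<in> I \<Longrightarrow> T i \<subseteq> A \<and> card (T i) = b"
  shows "real (card {X. X \<subseteq> A \<and> card X = m \<and> (\<forall>i\<in>I. \<not> T i \<subseteq> X)})
      * (real (card I) * hit_prob (card A) m b)\<^sup>2
    \<le> real (card A choose m) *
      (\<Sum>i\<in>I. \<Sum>j\<in>I. hit_prob (card A) m (card (T i \<union> T j)) - (hit_prob (card A) m b)\<^sup>2)"
proof -
  define \<Omega> where "\<Omega> = {X. X \<subseteq> A \<and> card X = m}"
  define q where "q = hit_prob (card A) m"
  define Y where "Y X = (\<Sum>i\<in>I. of_bool (T i \<subseteq> X) :: real)" for X
  define \<mu> where "\<mu> = real (card I) * q b"
  have fin: "finite \<Omega>" unfolding \<Omega>_def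
    by (rule finite_subset[of _ "Pow A"]) (use assms(1) in auto)
  have card\<Omega>: "card \<Omega> = card A choose m" unfolding \<Omega>_def by (rule n_subsets[OF assms(1)])
  have hits: "(\<Sum>X\<in>\<Omega>. of_bool (B \<subseteq> X)) = q (card B) * real (card \<Omega>)" if "B \<subseteq> A" for B
  proof -
    have "(\<Sum>X\<in>\<Omega>. of_bool (B \<subseteq> X) :: real) = real (card {X \<in> \<Omega>. B \<subseteq> X})"
      using fin by (simp add: Int_def)
    also have "{X \<in> \<Omega>. B \<subseteq> X} = {X. X \<subseteq> A \<and> card X = m \<and> B \<subseteq> X}"
      by (auto simp: \<Omega>_def)
    finally show ?thesis
      using card_supersets_hit_prob[OF assms(1) that assms(2)] by (simp add: card\<Omega> q_def)
  qed
  have "(\<Sum>X\<in>\<Omega>. Y X) = (\<Sum>i\<in>I. \<Sum>X\<in>\<Omega>. of_bool (T i \<subseteq> X))"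
    unfolding Y_def by (rule sum.swap)
  also have "\<dots> = (\<Sum>i\<in>I. q b * real (card \<Omega>))"
    using T hits by (intro sum.cong refl) metis
  finally have mean: "(\<Sum>X\<in>\<Omega>. Y X) = \<mu> * real (card \<Omega>)" by (simp add: \<mu>_def)
  \<comment> \<open>The product of the indicators of \<open>T i\<close> and \<open>T j\<close> is
    the indicator of their union, so \<open>hits\<close> evaluates the second moment.\<close>
  have "(\<Sum>X\<in>\<Omega>. (Y X)\<^sup>2) = (\<Sum>X\<in>\<Omega>. \<Sum>i\<in>I. \<Sum>j\<in>I. of_bool (T i \<union> T j \<subseteq> X))"
    unfolding Y_def power2_eq_square sum_product by (simp flip: of_bool_conj)
  also have "\<dots> = (\<Sum>i\<in>I. \<Sum>X\<in>\<Omega>. \<Sum>j\<in>I. of_bool (T i \<union> T j \<subseteq> X))"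
    by (rule sum.swap)
  also have "\<dots> = (\<Sum>i\<in>I. \<Sum>j\<in>I. \<Sum>X\<in>\<Omega>. of_bool (T i \<union> T j \<subseteq> X))"
    by (intro sum.cong refl sum.swap)
  also have "\<dots> = (\<Sum>i\<in>I. \<Sum>j\<in>I. q (card (T i \<union> T j)) * real (card \<Omega>))"
    using T by (intro sum.cong refl hits) auto
  finally have square: "(\<Sum>X\<in>\<Omega>. (Y X)\<^sup>2) = (\<Sum>i\<in>I. \<Sum>j\<in>I. q (card (T i \<union> T j))) * real (card \<Omega>)"
    by (simp add: sum_distrib_right)
  have "{X. X \<subseteq> A \<and> card X = m \<and> (\<forall>i\<in>I. \<not> T i \<subseteq> X)} = {X \<in> \<Omega>. Y X = 0}"
    using assms(3) by (auto simp: \<Omega>_def Y_def sum_nonneg_eq_0_iff)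
  then have "real (card {X. X \<subseteq> A \<and> card X = m \<and> (\<forall>i\<in>I. \<not> T i \<subseteq> X)}) * \<mu>\<^sup>2
      \<le> (\<Sum>i\<in>I. \<Sum>j\<in>I. q (card (T i \<union> T j))) * real (card \<Omega>) - real (card \<Omega>) * \<mu>\<^sup>2"
    using second_moment_finite[OF fin mean] by (simp add: square)
  also have "\<dots> = real (card \<Omega>) * (\<Sum>i\<in>I. \<Sum>j\<in>I. q (card (T i \<union> T j)) - (q b)\<^sup>2)"
    by (simp add: sum_subtractf \<mu>_def power_mult_distrib power2_eq_square algebra_simps)
  finally show ?thesis by (simp add: \<mu>_def q_def card\<Omega>)
qed

section \<open>Overlaps between two images of a covering\<close>

text \<open>By injectivity the part \<open>W\<close> of \<open>V\<close> sent into \<open>U\<close>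
  has exactly \<open>card U\<close> points. There are at most \<open>2 ^ card V\<close> choices of
  \<open>W\<close>; values on \<open>W\<close> lie in \<open>U\<close>, and the other points have
  \<open>n\<close> values each.\<close>

lemma card_maps_onto_le:
  assumes V: "finite V" and U: "finite U"
  shows "card {\<psi> \<in> V \<rightarrow>\<^sub>E {1..n}. inj_on \<psi> V \<and> U \<subseteq> \<psi> ` V}
    \<le> 2 ^ card V * (card V ^ card V * n ^ (card V - card U))" (is "card ?L \<le> _")
proof (cases "card U \<le> card V")
  case True
  define \<W> where "\<W> = {W. W \<subseteq> V \<and> card W = card U}"
  define P where "P W = (\<Pi>\<^sub>E x\<in>V. if x \<in> W then U else {1..n})" for W
  have fin: "finite \<W>" unfolding \<W>_def by (rule finite_subset[of _ "Pow V"]) (use V in auto)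
  have finP: "finite (P W)" for W unfolding P_def using V U by (intro finite_PiE) auto
  have "?L \<subseteq> (\<Union>W\<in>\<W>. P W)"
  proof
    fix \<psi> assume "\<psi> \<in> ?L"
    then have \<psi>: "\<psi> \<in> V \<rightarrow>\<^sub>E {1..n}" "inj_on \<psi> V" "U \<subseteq> \<psi> ` V" by auto
    define W where "W = {x\<in>V. \<psi> x \<in> U}"
    have "\<psi> ` W = U" using \<psi>(3) by (auto simp: W_def)
    moreover have "inj_on \<psi> W" using \<psi>(2) by (rule inj_on_subset) (auto simp: W_def)
    ultimately have "card W = card U" using card_image by metis
    then have "W \<in> \<W>" by (simp add: \<W>_def W_def)
    moreover have "\<psi> \<in> P W" using \<psi>(1) by (auto simp: P_def W_def PiE_iff)
    ultimately show "\<psi> \<in> (\<Union>W\<in>\<W>. P W)" by (rule UN_I)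
  qed
  then have "card ?L \<le> card (\<Union>W\<in>\<W>. P W)"
    by (rule card_mono[rotated]) (rule finite_UN_I[OF fin finP])
  also have "\<dots> \<le> (\<Sum>W\<in>\<W>. card (P W))" by (rule card_UN_le[OF fin])
  also have "\<dots> \<le> (\<Sum>W\<in>\<W>. card V ^ card V * n ^ (card V - card U))"
  proof (intro sum_mono)
    fix W assume "W \<in> \<W>"
    then have W: "W \<subseteq> V" "card W = card U" by (auto simp: \<W>_def)
    have finW: "finite W" using W(1) V by (rule finite_subset)
    have "card (P W) = (\<Prod>x\<in>V. if x \<in> W then card U else n)"
      unfolding P_def card_PiE[OF V] by (intro prod.cong) auto
    also have "\<dots> = (\<Prod>x\<in>V - W. if x \<in> W then card U else n) * (\<Prod>x\<in>W. if x \<in> W then card U else n)"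
      by (rule prod.subset_diff[OF W(1) V])
    also have "\<dots> = card U ^ card U * n ^ (card V - card U)"
      using W finW by (simp add: card_Diff_subset)
    also have "card U ^ card U \<le> card V ^ card V"
    proof (cases "card V = 0")
      case False
      have "card U ^ card U \<le> card V ^ card U" using True by (rule power_mono) simp
      also have "\<dots> \<le> card V ^ card V" using True False by (intro power_increasing) auto
      finally show ?thesis .
    qed (use True in simp)
    finally show "card (P W) \<le> card V ^ card V * n ^ (card V - card U)" by simp
  qed
  also have "\<dots> = card \<W> * (card V ^ card V * n ^ (card V - card U))" by simp
  also have "card \<W> \<le> 2 ^ card V"
    using card_mono[of "Pow V" \<W>] V by (auto simp: \<W>_def card_Pow)
  finally show ?thesis by simp
next
  case False
  \<comment> \<open>Here the truncated exponent \<open>card V - card U\<close> is 0, but no image of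
    \<open>V\<close> is large enough to contain \<open>U\<close>.\<close>
  have "?L = {}"
  proof (rule ccontr)
    assume "?L \<noteq> {}"
    then obtain \<psi> where "U \<subseteq> \<psi> ` V" by blast
    then show False using False surj_card_le[OF V] by blast
  qed
  then show ?thesis by (metis card.empty zero_le)
qed

text \<open>If the images are disjoint, \<open>hit_prob_double\<close> makes the left side
  nonpositive. Otherwise the exact overlap is one of the nonnegative summands and suffices alone.
  Summing over every \<open>D\<close> gives a bound whose index set is the same for all pairs of
  maps, so sums can be exchanged.\<close>

lemma hit_prob_overlap:
  assumes fin: "finite C" and inj: "inj_on f C" "inj_on g C" and m: "m \<le> N" "2 * card C \<le> m"
  shows "hit_prob N m (card (f ` C \<union> g ` C)) - (hit_prob N m (card C))\<^sup>2 \<le>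
    (\<Sum>D\<in>Pow C - {{}}. of_bool (f ` D \<subseteq> g ` C) * (real m / real N) ^ (2 * card C - card D))"
    (is "?l \<le> sum ?h _")
proof -
  define D where "D = {x\<in>C. f x \<in> g ` C}"
  have D: "D \<subseteq> C" "f ` D = f ` C \<inter> g ` C" by (auto simp: D_def)
  have cards: "card (f ` C) = card C" "card (g ` C) = card C" "card (f ` D) = card D"
    using inj inj_on_subset[OF inj(1) D(1)] by (simp_all add: card_image)
  have "card (f ` C) + card (g ` C) = card (f ` C \<union> g ` C) + card (f ` C \<inter> g ` C)"
    using fin by (intro card_Un_Int) auto
  then have union: "card (f ` C \<union> g ` C) = 2 * card C - card D"
    using cards D(2) by simp
  have nonneg: "0 \<le> ?h D'" for D' by simp
  show ?thesis
  proof (cases "D = {}")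
    case True
    then have "?l \<le> 0" using union hit_prob_double[OF m] by simp
    also have "0 \<le> sum ?h (Pow C - {{}})" by (rule sum_nonneg[OF nonneg])
    finally show ?thesis .
  next
    case False
    have "?l \<le> hit_prob N m (2 * card C - card D)" by (simp add: union)
    also have "\<dots> \<le> (real m / real N) ^ (2 * card C - card D)" by (rule hit_prob_le[OF m(1)])
    also have "\<dots> = ?h D" using D(2) by simp
    also have "\<dots> \<le> sum ?h (Pow C - {{}})"
      using False D(1) fin nonneg by (intro member_le_sum) auto
    finally show ?thesis .
  qed
qed

text \<open>Second moment over the injections of the vertices of \<open>C\<close> into
  \<open>{1..n}\<close>. In the constant, \<open>2 ^ card C\<close> counts the overlaps
  \<open>D\<close>, \<open>2 ^ a * a ^ a\<close> comes from \<open>card_maps_onto_le\<close>, the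
  other \<open>a ^ a\<close> from the lower bound on the number of injections, and
  \<open>4 ^ card C\<close> from squaring \<open>(p / 2) ^ card C\<close>.\<close>

lemma prob_not_contains_copy_le:
  fixes S :: "'s ugraph" and H :: "'h ugraph" and L :: real
  assumes S: "simple_graph S" "subgraph S (graph_Union C)"
    and C: "finite C" "\<forall>F\<in>C. simple_graph F \<and> isomorphic H F"
    and a: "a = card (verts (graph_Union C))"
    and m: "m \<le> card (copies H n)" "2 * card C \<le> m" "0 < m" and n: "a \<le> n" "0 < n"
    and p: "p = real m / real (card (copies H n))"
    and L: "0 < L" "\<And>D. \<lbrakk>D \<subseteq> C; D \<noteq> {}\<rbrakk> \<Longrightarrow> L \<le> real n ^ card (verts (graph_Union D)) * p ^ card D"
  shows "measure_pmf.prob (motif_graph H n m) {G. \<not> contains_copy G S}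
    \<le> 2 ^ card C * real (2 ^ a * a ^ a) * real (a ^ a) * 4 ^ card C / L"
proof -
  let ?V = "verts (graph_Union C)"
  let ?A = "copies H n"
  define b where "b = card C"
  define N where "N = card ?A"
  define \<Phi> where "\<Phi> = {\<phi> \<in> ?V \<rightarrow>\<^sub>E {1..n}. inj_on \<phi> ?V}"
  define T where "T \<phi> = map_graph \<phi> ` C" for \<phi> :: "'s \<Rightarrow> nat"
  define q where "q = hit_prob N m b"
  define K where "K = real (2 ^ a * a ^ a)"
  let ?bad = "{\<F>. \<F> \<subseteq> ?A \<and> card \<F> = m \<and> (\<forall>\<phi>\<in>\<Phi>. \<not> T \<phi> \<subseteq> \<F>)}"
  have finV: "finite ?V" using C by (intro finite_graph_Union) auto
  have fin\<Phi>: "finite \<Phi>" unfolding \<Phi>_def using finV by (simp add: finite_PiE)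
  have within: "C \<subseteq> {G. simple_graph G \<and> verts G \<subseteq> ?V}"
  proof
    fix F assume F: "F \<in> C"
    then show "F \<in> {G. simple_graph G \<and> verts G \<subseteq> ?V}"
      using C(2) verts_le_graph_Union[OF F] by simp
  qed
  have injT: "inj_on (map_graph \<phi>) C" if "\<phi> \<in> \<Phi>" for \<phi>
    by (rule inj_on_subset[OF inj_on_map_graph within]) (use that in \<open>simp add: \<Phi>_def\<close>)
  have T: "T \<phi> \<subseteq> ?A \<and> card (T \<phi>) = b" if \<phi>: "\<phi> \<in> \<Phi>" for \<phi>
  proof
    show "T \<phi> \<subseteq> ?A" unfolding T_def
    proof (rule image_subsetI)
      fix F assume F: "F \<in> C"
      have sub: "verts F \<subseteq> ?V" by (rule verts_le_graph_Union[OF F])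
      have "inj_on \<phi> (verts F)" using \<phi> inj_on_subset[OF _ sub, of \<phi>] by (simp add: \<Phi>_def)
      moreover have "\<phi> ` verts F \<subseteq> {1..n}" using \<phi> sub by (auto simp: \<Phi>_def)
      ultimately show "map_graph \<phi> F \<in> ?A" using C(2) F by (intro map_graph_in_copies) auto
    qed
    show "card (T \<phi>) = b" using injT[OF \<phi>] by (simp add: T_def b_def card_image)
  qed
  have contains: "contains_copy (graph_Union \<F>) S" if "\<phi> \<in> \<Phi>" "T \<phi> \<subseteq> \<F>" for \<phi> \<F>
    unfolding contains_copy_def
  proof (intro exI conjI)
    have "verts S \<subseteq> ?V" using S(2) by (simp add: subgraph_def)
    then have inj: "inj_on \<phi> (verts S)"
      using that(1) inj_on_subset[of \<phi> ?V "verts S"] by (simp add: \<Phi>_def)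
    show "simple_graph (map_graph \<phi> S)" by (rule simple_graph_map[OF S(1) inj])
    show "isomorphic S (map_graph \<phi> S)" by (rule isomorphic_map_graph_self[OF inj])
    have "subgraph (map_graph \<phi> S) (map_graph \<phi> (graph_Union C))"
      using S(2) by (simp add: subgraph_def image_mono)
    moreover have "subgraph (map_graph \<phi> (graph_Union C)) (graph_Union \<F>)"
      using graph_Union_mono[OF that(2)] by (simp add: T_def graph_Union_map)
    ultimately show "subgraph (map_graph \<phi> S) (graph_Union \<F>)"
      unfolding subgraph_def by blast
  qed
  have N: "0 < N" "0 < p" using m by (simp_all add: N_def p)
  have pN: "real m / real N = p" by (simp add: p N_def)
  have "a ^ a > 0" by (cases "a = 0") auto
  then have aa: "real (a ^ a) > 0" by simp
  have \<Phi>_ge: "(real n ^ a) / real (a ^ a) \<le> real (card \<Phi>)"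
  proof -
    have "(real n / real a) ^ a \<le> real (n choose a)" by (rule binomial_ge_n_over_k_pow_k[OF n(1)])
    also have "\<dots> \<le> real (card \<Phi>)"
      using binomial_le_card_inj[OF finV, of n] by (simp add: \<Phi>_def a)
    finally show ?thesis by (simp add: power_divide)
  qed
  have \<Phi>_pos: "0 < real (card \<Phi>)"
  proof -
    have "0 < (real n ^ a) / real (a ^ a)" using n aa by simp
    then show ?thesis using \<Phi>_ge by linarith
  qed
  \<comment> \<open>If the image of \<open>D\<close> under \<phi> lies in the image of
    \<open>C\<close> under \<psi>, the vertices of the former lie in the range of \<psi>, so
    \<open>card_maps_onto_le\<close> applies.\<close>
  have overlaps: "(\<Sum>\<psi>\<in>\<Phi>. of_bool (map_graph \<phi> ` D \<subseteq> T \<psi>)) \<le>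
      K * real n ^ (a - card (verts (graph_Union D)))"
    if \<phi>: "\<phi> \<in> \<Phi>" and D: "D \<subseteq> C" for \<phi> D
  proof -
    let ?U = "\<phi> ` verts (graph_Union D)"
    have sub: "verts (graph_Union D) \<subseteq> ?V" using graph_Union_mono[OF D] by (simp add: subgraph_def)
    have "inj_on \<phi> (verts (graph_Union D))" using \<phi> inj_on_subset[OF _ sub, of \<phi>] by (simp add: \<Phi>_def)
    then have cU: "card ?U = card (verts (graph_Union D))" by (rule card_image)
    have finU: "finite ?U" using finite_subset[OF sub finV] by simp
    have "(\<Sum>\<psi>\<in>\<Phi>. of_bool (map_graph \<phi> ` D \<subseteq> T \<psi>) :: real) =
        real (card {\<psi>\<in>\<Phi>. map_graph \<phi> ` D \<subseteq> T \<psi>})"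
      using fin\<Phi> by (simp add: Int_def)
    also have "{\<psi>\<in>\<Phi>. map_graph \<phi> ` D \<subseteq> T \<psi>} \<subseteq> {\<psi> \<in> ?V \<rightarrow>\<^sub>E {1..n}. inj_on \<psi> ?V \<and> ?U \<subseteq> \<psi> ` ?V}"
    proof
      fix \<psi> assume \<psi>: "\<psi> \<in> {\<psi>\<in>\<Phi>. map_graph \<phi> ` D \<subseteq> T \<psi>}"
      then have "subgraph (graph_Union (map_graph \<phi> ` D)) (graph_Union (map_graph \<psi> ` C))"
        by (intro graph_Union_mono) (simp add: T_def)
      then have "?U \<subseteq> \<psi> ` ?V" by (simp add: graph_Union_map subgraph_def)
      then show "\<psi> \<in> {\<psi> \<in> ?V \<rightarrow>\<^sub>E {1..n}. inj_on \<psi> ?V \<and> ?U \<subseteq> \<psi> ` ?V}"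
        using \<psi> by (simp add: \<Phi>_def)
    qed
    then have "real (card {\<psi>\<in>\<Phi>. map_graph \<phi> ` D \<subseteq> T \<psi>}) \<le>
        real (card {\<psi> \<in> ?V \<rightarrow>\<^sub>E {1..n}. inj_on \<psi> ?V \<and> ?U \<subseteq> \<psi> ` ?V})"
      by (intro of_nat_mono card_mono) (use finV in \<open>simp_all add: finite_PiE\<close>)
    also have "\<dots> \<le> real (2 ^ a * (a ^ a * n ^ (a - card ?U)))"
      unfolding a by (intro of_nat_mono card_maps_onto_le finV finU)
    also have "\<dots> = K * real n ^ (a - card (verts (graph_Union D)))"
      unfolding cU by (simp add: K_def)
    finally show ?thesis .
  qed
  \<comment> \<open>An overlap \<open>D\<close> saves the factor \<open>n ^ a' * p ^ card D\<close>,
    with \<open>a'\<close> the number of its vertices, and this is at least \<open>L\<close> by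
    assumption.\<close>
  have weight: "real n ^ (a - card (verts (graph_Union D))) * p ^ (2 * b - card D)
      \<le> real n ^ a * p ^ (2 * b) / L" if D: "D \<subseteq> C" "D \<noteq> {}" for D
  proof -
    let ?a = "card (verts (graph_Union D))"
    have sub: "verts (graph_Union D) \<subseteq> ?V" using graph_Union_mono[OF D(1)] by (simp add: subgraph_def)
    have le: "?a \<le> a" "card D \<le> 2 * b"
      unfolding a b_def using card_mono[OF finV sub] card_mono[OF C(1) D(1)] by auto
    have "real n ^ (a - ?a) * p ^ (2 * b - card D) * L \<le>
        real n ^ (a - ?a) * p ^ (2 * b - card D) * (real n ^ ?a * p ^ card D)"
      using N by (intro mult_left_mono L(2) D) auto
    also have "\<dots> = real n ^ (a - ?a + ?a) * p ^ (2 * b - card D + card D)"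
      by (simp only: power_add mult_ac)
    also have "\<dots> = real n ^ a * p ^ (2 * b)" using le by simp
    finally show ?thesis using L(1) by (simp add: le_divide_eq)
  qed
  have "(\<Sum>\<phi>\<in>\<Phi>. \<Sum>\<psi>\<in>\<Phi>. hit_prob N m (card (T \<phi> \<union> T \<psi>)) - q\<^sup>2)
      \<le> (\<Sum>\<phi>\<in>\<Phi>. \<Sum>\<psi>\<in>\<Phi>. \<Sum>D\<in>Pow C - {{}}. of_bool (map_graph \<phi> ` D \<subseteq> T \<psi>) * p ^ (2 * b - card D))"
    unfolding T_def q_def b_def pN[symmetric]
    using C(1) injT m by (intro sum_mono hit_prob_overlap) (auto simp: N_def)
  also have "\<dots> = (\<Sum>\<phi>\<in>\<Phi>. \<Sum>D\<in>Pow C - {{}}. \<Sum>\<psi>\<in>\<Phi>. of_bool (map_graph \<phi> ` D \<subseteq> T \<psi>) * p ^ (2 * b - card D))"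
    by (intro sum.cong refl sum.swap)
  also have "\<dots> = (\<Sum>\<phi>\<in>\<Phi>. \<Sum>D\<in>Pow C - {{}}. (\<Sum>\<psi>\<in>\<Phi>. of_bool (map_graph \<phi> ` D \<subseteq> T \<psi>)) * p ^ (2 * b - card D))"
    by (simp only: sum_distrib_right)
  also have "\<dots> \<le> (\<Sum>\<phi>\<in>\<Phi>. \<Sum>D\<in>Pow C - {{}}. K * (real n ^ a * p ^ (2 * b) / L))"
  proof (intro sum_mono)
    fix \<phi> D assume \<phi>: "\<phi> \<in> \<Phi>" and "D \<in> Pow C - {{}}"
    then have D: "D \<subseteq> C" "D \<noteq> {}" by auto
    have "(\<Sum>\<psi>\<in>\<Phi>. of_bool (map_graph \<phi> ` D \<subseteq> T \<psi>)) * p ^ (2 * b - card D)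
        \<le> K * real n ^ (a - card (verts (graph_Union D))) * p ^ (2 * b - card D)"
      using N by (intro mult_right_mono overlaps \<phi> D) auto
    also have "\<dots> \<le> K * (real n ^ a * p ^ (2 * b) / L)"
      unfolding mult.assoc by (intro mult_left_mono weight D) (simp add: K_def)
    finally show "(\<Sum>\<psi>\<in>\<Phi>. of_bool (map_graph \<phi> ` D \<subseteq> T \<psi>)) * p ^ (2 * b - card D)
        \<le> K * (real n ^ a * p ^ (2 * b) / L)" .
  qed
  also have "\<dots> = real (card \<Phi>) * (real (card (Pow C - {{}})) * (K * (real n ^ a * p ^ (2 * b) / L)))"
    by simp
  also have "\<dots> \<le> real (card \<Phi>) * (2 ^ b * (K * (real n ^ a * p ^ (2 * b) / L)))"
  proof -
    have "card (Pow C - {{}}) \<le> 2 ^ b"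
      using card_mono[of "Pow C" "Pow C - {{}}"] C(1) by (simp add: card_Pow b_def)
    then have "real (card (Pow C - {{}})) \<le> 2 ^ b"
      by (metis of_nat_le_iff of_nat_numeral of_nat_power)
    then show ?thesis using L(1) N by (intro mult_left_mono mult_right_mono) (auto simp: K_def)
  qed
  finally have variance: "(\<Sum>\<phi>\<in>\<Phi>. \<Sum>\<psi>\<in>\<Phi>. hit_prob N m (card (T \<phi> \<union> T \<psi>)) - q\<^sup>2)
      \<le> real (card \<Phi>) * (2 ^ b * (K * (real n ^ a * p ^ (2 * b) / L)))" .

  define P where "P = real (card ?bad) / real (N choose m)"
  have choose_pos: "0 < real (N choose m)" using m by (simp add: N_def)
  have P0: "0 \<le> P" by (simp add: P_def)
  have "real (card ?bad) * (real (card \<Phi>) * q)\<^sup>2 \<le> real (N choose m) *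
      (\<Sum>\<phi>\<in>\<Phi>. \<Sum>\<psi>\<in>\<Phi>. hit_prob N m (card (T \<phi> \<union> T \<psi>)) - q\<^sup>2)"
    unfolding N_def q_def by (rule second_moment_supersets[OF finite_copies m(1) fin\<Phi> T])
  then have "P * (real (card \<Phi>) * q)\<^sup>2 \<le>
      (\<Sum>\<phi>\<in>\<Phi>. \<Sum>\<psi>\<in>\<Phi>. hit_prob N m (card (T \<phi> \<union> T \<psi>)) - q\<^sup>2)"
    using choose_pos by (simp add: P_def divide_le_eq mult.commute)
  also note variance
  \<comment> \<open>One of the two factors \<open>card \<Phi>\<close> of the squared mean cancels;
    the other is bounded below by \<open>n ^ a / a ^ a\<close>.\<close>
  finally have "real (card \<Phi>) * (P * (real (card \<Phi>) * q\<^sup>2))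
      \<le> real (card \<Phi>) * (2 ^ b * (K * (real n ^ a * p ^ (2 * b) / L)))"
    by (simp only: power2_eq_square mult_ac)
  then have "P * (real (card \<Phi>) * q\<^sup>2) \<le> 2 ^ b * (K * (real n ^ a * p ^ (2 * b) / L))"
    using \<Phi>_pos by (simp only: mult_le_cancel_left_pos)
  moreover have "P * ((real n ^ a / real (a ^ a)) * ((p / 2) ^ b)\<^sup>2) \<le> P * (real (card \<Phi>) * q\<^sup>2)"
  proof (intro mult_left_mono mult_mono \<Phi>_ge power_mono P0)
    show "(p / 2) ^ b \<le> q"
      unfolding q_def pN[symmetric] b_def using hit_prob_ge[of m N "card C"] m
      by (simp add: N_def mult.commute)
  qed (use N in auto)
  ultimately have "P * ((real n ^ a / real (a ^ a)) * ((p / 2) ^ b)\<^sup>2)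
      \<le> 2 ^ b * (K * (real n ^ a * p ^ (2 * b) / L))" by linarith
  moreover have "((p / 2) ^ b)\<^sup>2 = p ^ (2 * b) / 4 ^ b"
  proof -
    have "((p / 2) ^ b)\<^sup>2 = ((p / 2)\<^sup>2) ^ b" by (simp only: power_mult[symmetric] mult.commute)
    also have "\<dots> = p ^ (2 * b) / 4 ^ b" by (simp add: power_divide power_mult)
    finally show ?thesis .
  qed
  ultimately have "(real n ^ a * p ^ (2 * b)) * (P / (real (a ^ a) * 4 ^ b))
      \<le> (real n ^ a * p ^ (2 * b)) * (2 ^ b * K / L)"
    by (simp add: mult_ac)
  then have "P / (real (a ^ a) * 4 ^ b) \<le> 2 ^ b * K / L"
    using n N by (subst (asm) mult_le_cancel_left_pos) auto
  then have P_le: "P \<le> 2 ^ b * K * real (a ^ a) * 4 ^ b / L"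
    using aa by (simp add: divide_le_eq mult_ac)

  have "card {\<F>. \<F> \<subseteq> ?A \<and> card \<F> = m \<and> \<not> contains_copy (graph_Union \<F>) S} \<le> card ?bad"
  proof (rule card_mono)
    show "finite ?bad"
      by (rule finite_subset[of _ "Pow ?A"]) (auto simp: finite_copies)
    show "{\<F>. \<F> \<subseteq> ?A \<and> card \<F> = m \<and> \<not> contains_copy (graph_Union \<F>) S} \<subseteq> ?bad"
      using contains by blast
  qed
  then have "measure_pmf.prob (motif_graph H n m) {G. \<not> contains_copy G S} \<le> P"
    unfolding prob_motif_graph[OF m(1)] P_def N_def by (intro divide_right_mono) auto
  with P_le show ?thesis by (simp add: K_def b_def)
qed

text \<open>For a covering attaining \<open>gamma_bar S H\<close>, each nonempty subfamily of
  \<open>b'\<close> copies on \<open>a'\<close> vertices satisfies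
  \<open>a' \<ge> \<gamma> * b'\<close>. Hence \<open>p \<ge> L * n powr (- \<gamma>)\<close> gives
  \<open>n ^ a' * p ^ b' \<ge> L ^ b' \<ge> L\<close>, the assumption of the second moment
  bound.\<close>

lemma prob_contains_copy_large:
  fixes S :: "'s::infinite ugraph" and H :: "'h ugraph"
  assumes H: "simple_graph H" "verts H \<noteq> {}" "no_isolated H"
    and S: "simple_graph S" "verts S \<noteq> {}"
  obtains K :: real and n\<^sub>0 :: nat where "0 < K"
    "\<And>n m L. \<lbrakk>m \<le> card (copies H n); n\<^sub>0 \<le> n; 1 \<le> L; real n\<^sub>0 \<le> L;
       L * real n powr (real (card (verts H)) - gamma_bar S H) \<le> real m\<rbrakk>
     \<Longrightarrow> measure_pmf.prob (motif_graph H n m) {G. \<not> contains_copy G S} \<le> K / L"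
proof -
  obtain C a\<^sub>0 b where cov: "covering H S a\<^sub>0 b C" and \<gamma>C: "gamma C = gamma_bar S H"
    using gamma_bar_attained[OF H S] .
  have C: "finite C" "\<forall>F\<in>C. simple_graph F \<and> isomorphic H F" "subgraph S (graph_Union C)"
    using cov by (auto simp: covering_def)
  define v where "v = card (verts H)"
  define \<gamma> where "\<gamma> = gamma_bar S H"
  define a where "a = card (verts (graph_Union C))"
  define K where "K = 2 ^ card C * real (2 ^ a * a ^ a) * real (a ^ a) * 4 ^ card C"
  have "C \<noteq> {}" using C(3) S(2) by (auto simp: subgraph_def graph_Union_def)
  then obtain F where F: "F \<in> C" by blast
  \<comment> \<open>A single copy as subfamily shows that \<gamma> is at most
    \<open>v\<close>.\<close>
  have "gamma C * real (card {F}) \<le> real (card (verts (graph_Union {F})))"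
    using F by (intro gamma_le C) auto
  moreover have "card (verts (graph_Union {F})) = v"
    using C(2) F isomorphic_card[of H F] by (simp add: graph_Union_def v_def)
  ultimately have \<gamma>v: "\<gamma> \<le> real v" using \<gamma>C by (simp add: \<gamma>_def)
  have "0 < K" unfolding K_def by (cases "a = 0") auto
  moreover have "measure_pmf.prob (motif_graph H n m) {G. \<not> contains_copy G S} \<le> K / L"
    if m: "m \<le> card (copies H n)" and n: "a + 2 * card C + 1 \<le> n"
      and L: "1 \<le> L" "real (a + 2 * card C + 1) \<le> L"
      and bound: "L * real n powr (real v - \<gamma>) \<le> real m" for n m L
  proof -
    define p where "p = real m / real (card (copies H n))"
    \<comment> \<open>The threshold is at least 1, so the lower bound on \<open>L\<close> passes to
      \<open>m\<close> and ensures \<open>2 * card C \<le> m\<close>.\<close>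
    have "1 \<le> real n powr (real v - \<gamma>)" using n \<gamma>v by (intro ge_one_powr_ge_zero) auto
    then have "L * 1 \<le> L * real n powr (real v - \<gamma>)" using L(1) by (intro mult_left_mono) auto
    then have "real (a + 2 * card C + 1) \<le> real m" using bound L(2) by linarith
    then have m': "2 * card C \<le> m" "0 < m" by auto
    have "real (card (copies H n)) \<le> real n ^ v"
      using card_copies_le[OF H(1), of n] by (metis of_nat_le_iff of_nat_power v_def)
    then have "(L * real n powr (real v - \<gamma>)) / real n ^ v \<le> p"
      unfolding p_def using bound m m' L by (intro frac_le) auto
    then have p: "L * real n powr (- \<gamma>) \<le> p"
      using n by (simp add: powr_diff powr_minus_divide powr_realpow)
    have weight: "L \<le> real n ^ card (verts (graph_Union D)) * p ^ card D"
      if D: "D \<subseteq> C" "D \<noteq> {}" for D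
    proof -
      let ?a = "card (verts (graph_Union D))"
      have "finite D" using D(1) C(1) by (rule finite_subset)
      then have cD: "1 \<le> card D" using D(2) by (simp add: Suc_le_eq card_gt_0_iff)
      have "\<gamma> * real (card D) \<le> real ?a" using gamma_le[OF C(1) D] \<gamma>C by (simp add: \<gamma>_def)
      then have "1 \<le> real n powr (real ?a - \<gamma> * real (card D))"
        using n by (intro ge_one_powr_ge_zero) auto
      moreover have "L \<le> L ^ card D" using power_increasing[OF cD L(1)] by simp
      ultimately have "L * 1 \<le> L ^ card D * real n powr (real ?a - \<gamma> * real (card D))"
        using L(1) by (intro mult_mono) auto
      also have "real n powr (real ?a - \<gamma> * real (card D)) =
          real n ^ ?a * real n powr (- \<gamma> * real (card D))"
        using n by (simp add: powr_diff powr_minus_divide powr_realpow)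
      also have "L ^ card D * (real n ^ ?a * real n powr (- \<gamma> * real (card D))) =
          real n ^ ?a * (L * real n powr (- \<gamma>)) ^ card D"
        using n by (simp add: power_mult_distrib powr_power mult_ac)
      also have "\<dots> \<le> real n ^ ?a * p ^ card D"
        using p L(1) by (intro mult_left_mono power_mono) auto
      finally show ?thesis by simp
    qed
    have "measure_pmf.prob (motif_graph H n m) {G. \<not> contains_copy G S}
        \<le> 2 ^ card C * real (2 ^ a * a ^ a) * real (a ^ a) * 4 ^ card C / L"
      by (rule prob_not_contains_copy_le[OF S(1) C(3,1,2) a_def m m' _ _ p_def]) (use n L(1) weight in auto)
    then show ?thesis by (simp add: K_def)
  qed
  ultimately show ?thesis
    \<comment> \<open>One number serves twice: as a bound on \<open>n\<close> it gives room for the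
      vertices of \<open>C\<close>, as a bound on \<open>L\<close> it makes \<open>m\<close>
      large.\<close>
    using that[of K "a + 2 * card C + 1"] by (simp add: v_def \<gamma>_def)
qed

section \<open>The threshold\<close>

theorem theorem8:
  fixes H :: "'h ugraph" and S :: "'s::infinite ugraph" and m :: "nat \<Rightarrow> nat"
  assumes "simple_graph H" and "verts H \<noteq> {}" and "no_isolated H"
    and "simple_graph S" and "verts S \<noteq> {}"
    and "\<forall>\<^sub>F n in sequentially. m n \<le> card (copies H n)"
  shows "((\<lambda>n. real (m n)) \<in> o(\<lambda>n. real n powr (real (card (verts H)) - gamma_bar S H)) \<longrightarrow>
            (\<lambda>n. measure_pmf.prob (motif_graph H n (m n)) {G. contains_copy G S}) \<longlonglongrightarrow> 0)
       \<and> ((\<lambda>n. real (m n)) \<in> \<omega>(\<lambda>n. real n powr (real (card (verts H)) - gamma_bar S H)) \<longrightarrow>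
            (\<lambda>n. measure_pmf.prob (motif_graph H n (m n)) {G. contains_copy G S}) \<longlonglongrightarrow> 1)"
proof (intro conjI impI)
  let ?t = "\<lambda>n. real n powr (real (card (verts H)) - gamma_bar S H)"
  let ?P = "\<lambda>n. measure_pmf.prob (motif_graph H n (m n)) {G. contains_copy G S}"
  let ?Q = "\<lambda>n. measure_pmf.prob (motif_graph H n (m n)) {G. \<not> contains_copy G S}"
  note le_copies = assms(6)
  {
    assume small: "(\<lambda>n. real (m n)) \<in> o(?t)"
    obtain K where K: "0 < K" and bound: "\<And>n m \<epsilon>. \<lbrakk>m \<le> card (copies H n); n \<ge> card (verts H);
        n \<ge> 1; 0 < \<epsilon>; \<epsilon> \<le> 1; real m \<le> \<epsilon> * ?t n\<rbrakk>
        \<Longrightarrow> measure_pmf.prob (motif_graph H n m) {G. contains_copy G S} \<le> K * \<epsilon>"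
      using prob_contains_copy_small[OF assms(1,4,5)] by metis
    show "?P \<longlonglongrightarrow> 0"
    proof (rule tendstoI)
      fix e :: real assume e: "0 < e"
      \<comment> \<open>The cap 1 is demanded by \<open>bound\<close>, and the factor 2 makes the
        final inequality strict.\<close>
      define \<epsilon> where "\<epsilon> = min 1 (e / (2 * K))"
      have \<epsilon>: "0 < \<epsilon>" "\<epsilon> \<le> 1" using e K by (auto simp: \<epsilon>_def)
      have "K * \<epsilon> \<le> K * (e / (2 * K))" using K by (intro mult_left_mono) (auto simp: \<epsilon>_def)
      also have "\<dots> < e" using e K by simp
      finally have Ke: "K * \<epsilon> < e" .
      show "\<forall>\<^sub>F n in sequentially. dist (?P n) 0 < e"
        using landau_o.smallD[OF small \<epsilon>(1)] le_copies eventually_ge_at_top[of "card (verts H)"]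
          eventually_ge_at_top[of 1]
      proof eventually_elim
        case (elim n)
        have "?P n \<le> K * \<epsilon>" using elim \<epsilon> by (intro bound) auto
        with Ke show ?case by (simp add: dist_real_def)
      qed
    qed
  }
  {
    assume large: "(\<lambda>n. real (m n)) \<in> \<omega>(?t)"
    obtain K n\<^sub>0 where K: "0 < K" and bound: "\<And>n m L. \<lbrakk>m \<le> card (copies H n); n\<^sub>0 \<le> n; 1 \<le> L;
        real n\<^sub>0 \<le> L; L * ?t n \<le> real m\<rbrakk>
        \<Longrightarrow> measure_pmf.prob (motif_graph H n m) {G. \<not> contains_copy G S} \<le> K / L"
      using prob_contains_copy_large[OF assms(1-5)] by metis
    have "?Q \<longlonglongrightarrow> 0"
    proof (rule tendstoI)
      fix e :: real assume e: "0 < e"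
      \<comment> \<open>The first two terms meet the conditions of \<open>bound\<close>; the last
        makes \<open>K / L\<close> at most \<open>e / 2\<close>.\<close>
      define L where "L = max (max 1 (real n\<^sub>0)) (2 * K / e)"
      have L: "1 \<le> L" "real n\<^sub>0 \<le> L" "2 * K / e \<le> L" by (auto simp: L_def)
      have "K / L \<le> K / (2 * K / e)" using K e L by (intro divide_left_mono mult_pos_pos) auto
      also have "\<dots> < e" using e K by simp
      finally have KL: "K / L < e" .
      have "0 < L" using L(1) by simp
      show "\<forall>\<^sub>F n in sequentially. dist (?Q n) 0 < e"
        using landau_omega.smallD[OF large \<open>0 < L\<close>] le_copies eventually_ge_at_top[of n\<^sub>0]
      proof eventually_elim
        case (elim n)
        have "?Q n \<le> K / L" using elim L by (intro bound) auto
        with KL show ?case by (simp add: dist_real_def)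
      qed
    qed
    moreover have "?P n = 1 - ?Q n" for n
      using measure_pmf.prob_compl[of "{G. \<not> contains_copy G S}" "motif_graph H n (m n)"]
      by (simp add: Compl_eq_Diff_UNIV[symmetric] Collect_neg_eq[symmetric])
    ultimately show "?P \<longlonglongrightarrow> 1"
      using tendsto_diff[OF tendsto_const[of 1], of ?Q 0 sequentially] by simp
  }
qed

end
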